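(* Let $\mathbb{P}^4\subset\mathbb{P}^5$ be the hyperplane $x_0+x_1+x_2+x_3+x_4+x_5=0$, where $x_0,\ldots,x_5$ are homogeneous coordinates on $\mathbb{P}^5$ over $\mathbb{C}$. For $t\in\mathbb{C}$ let $X_t\subset\mathbb{P}^4$ be the quartic threefold given by $$x_0^4+x_1^4+x_2^4+x_3^4+x_4^4+x_5^4=t\Big(x_0^2+x_1^2+x_2^2+x_3^2+x_4^2+x_5^2\Big)^2.$$ Then the quartic threefolds $X_{\frac{1}{6}}$ and $X_{\frac{7}{10}}$ are rational. *)

theory Defs
  imports Complex_Main
begin

text \<open>Points of the affine space C^k (the cone over P^(k-1)) are functions
  nat => complex vanishing at all indices >= k.\<close>
definition cspace :: "nat \<Rightarrow> (nat \<Rightarrow> complex) set" where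
  "cspace k = {x. \<forall>i\<ge>k. x i = 0}"

inductive_set polyfun :: "nat \<Rightarrow> ((nat \<Rightarrow> complex) \<Rightarrow> complex) set" for k :: nat where
  const: "(\<lambda>x. c) \<in> polyfun k"
| var: "i < k \<Longrightarrow> (\<lambda>x. x i) \<in> polyfun k"
| add: "f \<in> polyfun k \<Longrightarrow> g \<in> polyfun k \<Longrightarrow> (\<lambda>x. f x + g x) \<in> polyfun k"
| mult: "f \<in> polyfun k \<Longrightarrow> g \<in> polyfun k \<Longrightarrow> (\<lambda>x. f x * g x) \<in> polyfun k"

definition homog :: "nat \<Rightarrow> nat \<Rightarrow> ((nat \<Rightarrow> complex) \<Rightarrow> complex) \<Rightarrow> bool" where
  "homog k d f \<longleftrightarrow> f \<in> polyfun k \<and> (\<forall>c x. f (\<lambda>i. c * x i) = c ^ d * f x)"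

text \<open>A projective algebraic set in P^N, represented by its affine cone in C^(N+1):
  the common zero set of a family of homogeneous polynomials.\<close>
definition proj_alg_set :: "nat \<Rightarrow> (nat \<Rightarrow> complex) set \<Rightarrow> bool" where
  "proj_alg_set N C \<longleftrightarrow>
     (\<exists>S. (\<forall>f\<in>S. \<exists>d. homog (Suc N) d f) \<and> C = {x \<in> cspace (Suc N). \<forall>f\<in>S. f x = 0})"

definition vanishes_on :: "(nat \<Rightarrow> complex) set \<Rightarrow> ((nat \<Rightarrow> complex) \<Rightarrow> complex) \<Rightarrow> bool" where
  "vanishes_on C f \<longleftrightarrow> (\<forall>x\<in>C. f x = 0)"

definition proj_irreducible :: "nat \<Rightarrow> (nat \<Rightarrow> complex) set \<Rightarrow> bool" where
  "proj_irreducible N C \<longleftrightarrow> (\<exists>x\<in>C. x \<noteq> (\<lambda>_. 0)) \<and>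
     (\<forall>f\<in>polyfun (Suc N). \<forall>g\<in>polyfun (Suc N).
        vanishes_on C (\<lambda>x. f x * g x) \<longrightarrow> vanishes_on C f \<or> vanishes_on C g)"

definition pmap :: "nat \<Rightarrow> (nat \<Rightarrow> (nat \<Rightarrow> complex) \<Rightarrow> complex) \<Rightarrow> (nat \<Rightarrow> complex) \<Rightarrow> (nat \<Rightarrow> complex)" where
  "pmap m F x = (\<lambda>j. if j \<le> m then F j x else 0)"

definition proportional :: "(nat \<Rightarrow> complex) \<Rightarrow> (nat \<Rightarrow> complex) \<Rightarrow> bool" where
  "proportional x y \<longleftrightarrow> (\<exists>c. c \<noteq> 0 \<and> y = (\<lambda>i. c * x i))"

text \<open>Birational equivalence of the (irreducible) projective variety with cone C in P^N
  and P^m: rational maps phi = (F_0:...:F_m) : X --> P^m and psi = (G_0:...:G_N) : P^m --> X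
  which are mutually inverse on nonempty Zariski open subsets {g ~= 0} of X and
  {h ~= 0} of P^m.\<close>
definition birational_to_Pn :: "nat \<Rightarrow> (nat \<Rightarrow> complex) set \<Rightarrow> nat \<Rightarrow> bool" where
  "birational_to_Pn N C m \<longleftrightarrow>
    (\<exists>d F e G dg g dh h.
       (\<forall>j\<le>m. homog (Suc N) d (F j)) \<and> (\<forall>i\<le>N. homog (Suc m) e (G i)) \<and>
       homog (Suc N) dg g \<and> \<not> vanishes_on C g \<and>
       homog (Suc m) dh h \<and> \<not> vanishes_on (cspace (Suc m)) h \<and>
       (\<forall>x\<in>C. x \<noteq> (\<lambda>_. 0) \<and> g x \<noteq> 0 \<longrightarrow>
          pmap m F x \<noteq> (\<lambda>_. 0) \<and> proportional x (pmap N G (pmap m F x))) \<and>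
       (\<forall>y\<in>cspace (Suc m). y \<noteq> (\<lambda>_. 0) \<and> h y \<noteq> 0 \<longrightarrow>
          pmap N G y \<noteq> (\<lambda>_. 0) \<and> pmap N G y \<in> C \<and> proportional y (pmap m F (pmap N G y))))"

definition rational_proj_variety :: "nat \<Rightarrow> (nat \<Rightarrow> complex) set \<Rightarrow> bool" where
  "rational_proj_variety N C \<longleftrightarrow>
     proj_alg_set N C \<and> proj_irreducible N C \<and> (\<exists>m. birational_to_Pn N C m)"

definition quartic_cone :: "complex \<Rightarrow> (nat \<Rightarrow> complex) set" where
  "quartic_cone t = {x \<in> cspace 6. (\<Sum>i<6. x i) = 0 \<and>
      (\<Sum>i<6. x i ^ 4) = t * (\<Sum>i<6. x i ^ 2) ^ 2}"

end

theory Submission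
  imports Defs "HOL-Computational_Algebra.Polynomial"
begin

text \<open>
  Both quartics are determinants \<open>det (M x) = 0\<close> of a 4 x 4 matrix of linear forms in five variables.
  The kernel of \<open>M x\<close> defines a rational map to \<open>P^3\<close>, given by cubic cofactors; its inverse sends
  \<open>y\<close> to the kernel of the 4 x 5 matrix \<open>N y\<close> with \<open>M x \<cdot> y = N y \<cdot> x\<close>, given by
  quartic maximal minors.

  The determinantal representations are equivariant under the binary tetrahedral group, acting on the
  six coordinates as on three pairs \<open>{x 0, x 1}\<close>, \<open>{x 2, x 3}\<close>, \<open>{x 4, x 5}\<close>. With \<open>w\<close> a
  primitive cube root of unity, \<open>s\<close> and \<open>y\<close> the sums and differences of the pairs,
  \<open>u = \<Sum>k. w^k s_k\<close>, \<open>v = \<Sum>k. w^(2k) s_k\<close>, and \<open>X_e = \<Sum>k. w^(ek) y_k q_k\<close> for quaternion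
  units \<open>q_k\<close>, the matrices are \<open>[[u, u + X_1], [v + X_2, 2/3 v]]\<close> for \<open>t = 1/6\<close> and
  \<open>[[X_0, u - r X_1], [v + r X_2, 2/3 X_0]]\<close> with \<open>r^2 = -5/3\<close> for \<open>t = 7/10\<close>.

  Irreducibility: a product vanishing on the quartic pulls back to \<open>P^3\<close>, so one factor vanishes
  where the inverse map is defined. That set is dense, by continuity of the roots of the
  quartic over the first four coordinates.
\<close>

section \<open>Polynomial functions\<close>

lemma polyfun_uminus: "f \<in> polyfun k \<Longrightarrow> (\<lambda>x. - f x) \<in> polyfun k"
  using polyfun.mult[OF polyfun.const[of "-1" k]] by simp

lemma polyfun_diff: "f \<in> polyfun k \<Longrightarrow> g \<in> polyfun k \<Longrightarrow> (\<lambda>x. f x - g x) \<in> polyfun k"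
  using polyfun.add[of f k "\<lambda>x. - g x"] polyfun_uminus[of g k] by simp

lemma polyfun_power: "f \<in> polyfun k \<Longrightarrow> (\<lambda>x. f x ^ n) \<in> polyfun k"
  by (induction n) (simp_all add: polyfun.const polyfun.mult)

lemma polyfun_sum: "(\<And>i. i \<in> A \<Longrightarrow> f i \<in> polyfun k) \<Longrightarrow> (\<lambda>x. \<Sum>i\<in>A. f i x) \<in> polyfun k"
  by (induction A rule: infinite_finite_induct) (simp_all add: polyfun.const polyfun.add)

lemmas polyfun_intros = polyfun.intros polyfun_uminus polyfun_diff polyfun_power polyfun_sum

lemma polyfun_compose:
  assumes "f \<in> polyfun k" "\<And>i. i < k \<Longrightarrow> (\<lambda>x. \<phi> x i) \<in> polyfun m"
  shows "(\<lambda>x. f (\<phi> x)) \<in> polyfun m"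
  using assms by induction (simp_all add: polyfun.const polyfun.add polyfun.mult)

text \<open>Points are functions on all of \<open>nat\<close>, so maps between cones have to be
  compared on finitely many coordinates.\<close>

lemma polyfun_cong:
  assumes "f \<in> polyfun k" "\<And>i. i < k \<Longrightarrow> x i = y i"
  shows "f x = f y"
  using assms by induction simp_all

text \<open>Reduces questions about zeros to one variable, where a nonzero polynomial has finitely
  many roots.\<close>

lemma polyfun_line:
  assumes "f \<in> polyfun k"
  shows "\<exists>p. \<forall>s. f (\<lambda>i. a i + s * b i) = poly p s"
  using assms
proof induction
  case (const c)
  show ?case by (rule exI[of _ "[:c:]"]) simp
next
  case (var i)
  show ?case by (rule exI[of _ "[:a i, b i:]"]) simp
next
  case (add f g)
  then obtain p q where "\<forall>s. f (\<lambda>i. a i + s * b i) = poly p s" "\<forall>s. g (\<lambda>i. a i + s * b i) = poly q s"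
    by blast
  then show ?case by (intro exI[of _ "p + q"]) simp
next
  case (mult f g)
  then obtain p q where "\<forall>s. f (\<lambda>i. a i + s * b i) = poly p s" "\<forall>s. g (\<lambda>i. a i + s * b i) = poly q s"
    by blast
  then show ?case by (intro exI[of _ "p * q"]) simp
qed

lemma polyfun_tendsto:
  assumes "f \<in> polyfun k" "\<And>i. i < k \<Longrightarrow> ((\<lambda>s. \<phi> s i) \<longlongrightarrow> a i) F"
  shows "((\<lambda>s. f (\<phi> s)) \<longlongrightarrow> f a) F"
  using assms by induction (simp_all add: tendsto_add tendsto_mult)

text \<open>Irreducibility of affine space: on the line through a point where \<open>f\<close> is
  nonzero and one where \<open>g\<close> is nonzero, both restrict to nonzero polynomials.\<close>

lemma polyfun_mult_eq_0:
  assumes f: "f \<in> polyfun k" and g: "g \<in> polyfun k" and fg: "\<And>x. x \<in> cspace k \<Longrightarrow> f x * g x = 0"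
  shows "(\<forall>x\<in>cspace k. f x = 0) \<or> (\<forall>x\<in>cspace k. g x = 0)"
proof (rule ccontr)
  assume "\<not> ?thesis"
  then obtain a b where a: "a \<in> cspace k" "f a \<noteq> 0" and b: "b \<in> cspace k" "g b \<noteq> 0"
    by blast
  obtain p where p: "f (\<lambda>i. a i + s * (b i - a i)) = poly p s" for s
    using polyfun_line[OF f, of a "\<lambda>i. b i - a i"] by blast
  obtain q where q: "g (\<lambda>i. a i + s * (b i - a i)) = poly q s" for s
    using polyfun_line[OF g, of a "\<lambda>i. b i - a i"] by blast
  have "(\<lambda>i. a i + s * (b i - a i)) \<in> cspace k" for s
    using a(1) b(1) by (auto simp: cspace_def)
  from fg[OF this] have "poly (p * q) s = 0" for s
    unfolding p q by simp
  then have "p * q = 0"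
    using poly_all_0_iff_0 by blast
  moreover have "poly p 0 \<noteq> 0" "poly q 1 \<noteq> 0"
    using a(2) b(2) p[of 0] q[of 1] by auto
  ultimately show False
    by auto
qed

section \<open>Homogeneous polynomial functions\<close>

lemma homog_zero:
  assumes "homog k d f" "d > 0"
  shows "f (\<lambda>_. 0) = 0"
proof -
  have "\<And>c x. f (\<lambda>i. c * x i) = c ^ d * f x"
    using assms(1) unfolding homog_def by blast
  from this[of 0 "\<lambda>_. 0"] have "f (\<lambda>_. 0) = 0 ^ d * f (\<lambda>_. 0)"
    by (simp only: mult_zero_left)
  then show ?thesis
    using assms(2) by (simp add: zero_power)
qed

text \<open>The inner map occurs as a family \<open>\<phi>\<close> of homogeneous functions and as a
  map \<open>\<psi>\<close> on points, matched at the indices that \<open>f\<close> sees.\<close>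

lemma homog_compose:
  assumes f: "homog k d f" and \<phi>: "\<And>i. i < k \<Longrightarrow> homog m e (\<phi> i)"
    and eq: "\<And>x i. i < k \<Longrightarrow> \<psi> x i = \<phi> i x"
  shows "homog m (e * d) (\<lambda>x. f (\<psi> x))"
proof -
  have pf: "f \<in> polyfun k"
    using f by (simp add: homog_def)
  have "(\<lambda>x. \<psi> x i) \<in> polyfun m" if "i < k" for i
    using \<phi>[OF that] unfolding eq[OF that] homog_def by blast
  then have "(\<lambda>x. f (\<psi> x)) \<in> polyfun m"
    by (rule polyfun_compose[OF pf])
  moreover have "f (\<psi> (\<lambda>i. c * x i)) = c ^ (e * d) * f (\<psi> x)" for c x
  proof -
    have "\<psi> (\<lambda>i. c * x i) i = c ^ e * \<psi> x i" if "i < k" for i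
      using \<phi>[OF that] unfolding eq[OF that] homog_def by blast
    then have "f (\<psi> (\<lambda>i. c * x i)) = f (\<lambda>i. c ^ e * \<psi> x i)"
      by (rule polyfun_cong[OF pf])
    also have "\<dots> = (c ^ e) ^ d * f (\<psi> x)"
      using f unfolding homog_def by blast
    finally show ?thesis
      by (simp add: power_mult)
  qed
  ultimately show ?thesis
    unfolding homog_def by blast
qed

section \<open>Minors\<close>

lemma sum_less_4: "(\<Sum>i<4. f i) = f 0 + f 1 + f 2 + f (3::nat)"
  by (simp add: eval_nat_numeral)

lemma sum_less_5: "(\<Sum>i<5. f i) = f 0 + f 1 + f 2 + f 3 + f (4::nat)"
  by (simp add: eval_nat_numeral)

lemma sum_less_6: "(\<Sum>i<6. f i) = f 0 + f 1 + f 2 + f 3 + f 4 + f (5::nat)"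
  by (simp add: eval_nat_numeral)

lemma lessThan_4: "{..<4} = {0, 1, 2, 3 :: nat}"
  by auto

lemma lessThan_5: "{..<5} = {0, 1, 2, 3, 4 :: nat}"
  by auto

lemma less_4_cases: "i < 4 \<Longrightarrow> i = 0 \<or> i = 1 \<or> i = 2 \<or> i = (3::nat)"
  by arith

lemma less_5_cases: "i < 5 \<Longrightarrow> i = 0 \<or> i = 1 \<or> i = 2 \<or> i = 3 \<or> i = (4::nat)"
  by arith

text \<open>The minor on rows \<open>i\<close>, \<open>j\<close>, \<open>k\<close> and columns
  \<open>a\<close>, \<open>b\<close>, \<open>c\<close>; free indices let it serve 4 x 4 and 4 x 5
  matrices alike.\<close>

definition det3 :: "(nat \<Rightarrow> nat \<Rightarrow> 'a::comm_ring_1) \<Rightarrow> nat \<Rightarrow> nat \<Rightarrow> nat \<Rightarrow> nat \<Rightarrow> nat \<Rightarrow> nat \<Rightarrow> 'a" where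
  "det3 A i j k a b c =
     A i a * (A j b * A k c - A j c * A k b)
   - A i b * (A j a * A k c - A j c * A k a)
   + A i c * (A j a * A k b - A j b * A k a)"

definition det4 :: "(nat \<Rightarrow> nat \<Rightarrow> 'a::comm_ring_1) \<Rightarrow> nat \<Rightarrow> nat \<Rightarrow> nat \<Rightarrow> nat \<Rightarrow> 'a" where
  "det4 A a b c d =
     A 0 a * det3 A 1 2 3 b c d - A 0 b * det3 A 1 2 3 a c d
   + A 0 c * det3 A 1 2 3 a b d - A 0 d * det3 A 1 2 3 a b c"

text \<open>First column of the adjugate. If nonzero, it spans the kernel of a singular
  matrix.\<close>

definition row0_cofactor :: "(nat \<Rightarrow> nat \<Rightarrow> 'a::comm_ring_1) \<Rightarrow> nat \<Rightarrow> 'a" where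
  "row0_cofactor A j =
     (if j = 0 then det3 A 1 2 3 1 2 3 else if j = 1 then - det3 A 1 2 3 0 2 3
      else if j = 2 then det3 A 1 2 3 0 1 3 else - det3 A 1 2 3 0 1 2)"

text \<open>Generalized cross product of the four rows of a 4 x 5 matrix. If nonzero, it spans the
  kernel.\<close>

definition max_minor :: "(nat \<Rightarrow> nat \<Rightarrow> 'a::comm_ring_1) \<Rightarrow> nat \<Rightarrow> 'a" where
  "max_minor A l =
     (if l = 0 then det4 A 1 2 3 4 else if l = 1 then - det4 A 0 2 3 4
      else if l = 2 then det4 A 0 1 3 4 else if l = 3 then - det4 A 0 1 2 4 else det4 A 0 1 2 3)"

lemma det4_col:
  "det4 A a b c d = A 0 a * det3 A 1 2 3 b c d - A 1 a * det3 A 0 2 3 b c d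
     + A 2 a * det3 A 0 1 3 b c d - A 3 a * det3 A 0 1 2 b c d"
  by (simp add: det4_def det3_def algebra_simps)

lemma det4_alternating:
  "det4 A b a c d = - det4 A a b c d"
  "det4 A a c b d = - det4 A a b c d"
  "det4 A a b d c = - det4 A a b c d"
  by (simp_all add: det4_def det3_def algebra_simps)

lemma det4_repeated: "det4 A b b c d = 0" "det4 A c b c d = 0" "det4 A d b c d = 0"
  by (simp_all add: det4_def det3_def algebra_simps)

text \<open>\<open>det4_def\<close> expands along row 0; the expansions along the other rows show
  that \<open>max_minor\<close> is orthogonal to these too.\<close>

lemma det4_row:
  "det4 A a b c d = - (A 1 a * det3 A 0 2 3 b c d - A 1 b * det3 A 0 2 3 a c d
     + A 1 c * det3 A 0 2 3 a b d - A 1 d * det3 A 0 2 3 a b c)"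
  "det4 A a b c d = A 2 a * det3 A 0 1 3 b c d - A 2 b * det3 A 0 1 3 a c d
     + A 2 c * det3 A 0 1 3 a b d - A 2 d * det3 A 0 1 3 a b c"
  "det4 A a b c d = - (A 3 a * det3 A 0 1 2 b c d - A 3 b * det3 A 0 1 2 a c d
     + A 3 c * det3 A 0 1 2 a b d - A 3 d * det3 A 0 1 2 a b c)"
  by (simp_all add: det4_def det3_def algebra_simps)

text \<open>Laplace expansion for \<open>i = 0\<close>; otherwise a determinant in which row
  \<open>i\<close> occurs twice.\<close>

lemma row0_cofactor_expand:
  assumes "i < 4"
  shows "(\<Sum>j<4. A i j * row0_cofactor A j) = (if i = 0 then det4 A 0 1 2 3 else 0)"
  using less_4_cases[OF assms]
  by (elim disjE) (simp_all add: sum_less_4 row0_cofactor_def det4_def det3_def algebra_simps)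

text \<open>The sum is a 5 x 5 determinant with row \<open>i\<close> repeated; expanding each minor
  along row \<open>i\<close> makes the terms cancel in pairs.\<close>

lemma max_minor_expand:
  assumes "i < 4"
  shows "(\<Sum>l<5. A i l * max_minor A l) = 0"
proof -
  have "(\<Sum>l<5. A 0 l * max_minor A l) = 0"
    by (simp add: sum_less_5 max_minor_def det4_def algebra_simps)
  moreover have "(\<Sum>l<5. A 1 l * max_minor A l) = 0"
    unfolding sum_less_5 max_minor_def det4_row(1) by (simp add: algebra_simps)
  moreover have "(\<Sum>l<5. A 2 l * max_minor A l) = 0"
    unfolding sum_less_5 max_minor_def det4_row(2) by (simp add: algebra_simps)
  moreover have "(\<Sum>l<5. A 3 l * max_minor A l) = 0"
    unfolding sum_less_5 max_minor_def det4_row(3) by (simp add: algebra_simps)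
  ultimately show ?thesis
    using less_4_cases[OF assms] by (elim disjE) simp_all
qed

text \<open>Cramer's rule: kernel vectors are proportional to the cofactor vector. The
  cross-multiplied form avoids division.\<close>

lemma row0_cofactor_kernel:
  fixes A :: "nat \<Rightarrow> nat \<Rightarrow> 'a::comm_ring_1"
  assumes rows: "\<And>i. i < 4 \<Longrightarrow> (\<Sum>j<4. A i j * z j) = 0" and "a < 4" "b < 4"
  shows "z a * row0_cofactor A b = z b * row0_cofactor A a"
proof -
  have cramer: "z a * det3 A 1 2 3 a c d = - (z b * det3 A 1 2 3 b c d)"
    if "set [a, b, c, d] = {..<4}" "distinct [a, b, c, d]" for a b c d
  proof -
    have r: "A i a * z a + A i b * z b + A i c * z c + A i d * z d = 0" if "i < 4" for i
    proof -
      have "(\<Sum>j\<in>set [a, b, c, d]. A i j * z j) = 0"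
        using rows[OF that] \<open>set [a, b, c, d] = {..<4}\<close> by metis
      then show ?thesis
        using \<open>distinct [a, b, c, d]\<close> by (simp add: add.assoc)
    qed
    \<comment> \<open>The 2 x 2 minors of columns \<open>c\<close>, \<open>d\<close> eliminate
      \<open>z c\<close> and \<open>z d\<close> from rows 1 to 3.\<close>
    have "z a * det3 A 1 2 3 a c d + z b * det3 A 1 2 3 b c d
      = (A 2 c * A 3 d - A 2 d * A 3 c) * (A 1 a * z a + A 1 b * z b + A 1 c * z c + A 1 d * z d)
      - (A 1 c * A 3 d - A 1 d * A 3 c) * (A 2 a * z a + A 2 b * z b + A 2 c * z c + A 2 d * z d)
      + (A 1 c * A 2 d - A 1 d * A 2 c) * (A 3 a * z a + A 3 b * z b + A 3 c * z c + A 3 d * z d)"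
      by (simp add: det3_def algebra_simps)
    then show ?thesis using r[of 1] r[of 2] r[of 3] by (simp add: eq_neg_iff_add_eq_0)
  qed
  have swap: "det3 A 1 2 3 1 0 c = - det3 A 1 2 3 0 1 c" "det3 A 1 2 3 2 0 c = - det3 A 1 2 3 0 2 c"
    "det3 A 1 2 3 3 0 c = - det3 A 1 2 3 0 3 c" "det3 A 1 2 3 2 1 c = - det3 A 1 2 3 1 2 c"
    "det3 A 1 2 3 3 1 c = - det3 A 1 2 3 1 3 c" "det3 A 1 2 3 a 2 1 = - det3 A 1 2 3 a 1 2"
    "det3 A 1 2 3 a 3 1 = - det3 A 1 2 3 a 1 3" "det3 A 1 2 3 a 3 2 = - det3 A 1 2 3 a 2 3" for a c
    by (simp_all add: det3_def algebra_simps)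
  have *: "z 0 * row0_cofactor A 1 = z 1 * row0_cofactor A 0"
    "z 0 * row0_cofactor A 2 = z 2 * row0_cofactor A 0"
    "z 0 * row0_cofactor A 3 = z 3 * row0_cofactor A 0"
    "z 1 * row0_cofactor A 2 = z 2 * row0_cofactor A 1"
    "z 1 * row0_cofactor A 3 = z 3 * row0_cofactor A 1"
    "z 2 * row0_cofactor A 3 = z 3 * row0_cofactor A 2"
    \<comment> \<open>One instance per pair of columns; sorting the columns produces the signs in
      \<open>row0_cofactor\<close>.\<close>
    using cramer[of 0 1 2 3] cramer[of 0 2 1 3] cramer[of 0 3 1 2] cramer[of 2 1 0 3, symmetric]
      cramer[of 1 3 0 2] cramer[of 2 3 0 1]
    by (simp_all add: row0_cofactor_def swap lessThan_4 insert_commute del: One_nat_def)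
  show ?thesis
    using less_4_cases[OF assms(2)] less_4_cases[OF assms(3)] * by (elim disjE) simp_all
qed

lemma max_minor_kernel:
  fixes A :: "nat \<Rightarrow> nat \<Rightarrow> 'a::comm_ring_1"
  assumes rows: "\<And>i. i < 4 \<Longrightarrow> (\<Sum>l<5. A i l * z l) = 0" and "a < 5" "b < 5"
  shows "z a * max_minor A b = z b * max_minor A a"
proof -
  have cramer: "z a * det4 A a c d e = - (z b * det4 A b c d e)"
    if "set [a, b, c, d, e] = {..<5}" "distinct [a, b, c, d, e]" for a b c d e
  proof -
    let ?r = "\<lambda>i. A i a * z a + A i b * z b + A i c * z c + A i d * z d + A i e * z e"
    have r: "?r i = 0" if "i < 4" for i
    proof -
      have "(\<Sum>j\<in>set [a, b, c, d, e]. A i j * z j) = 0"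
        using rows[OF that] \<open>set [a, b, c, d, e] = {..<5}\<close> by metis
      then show ?thesis
        using \<open>distinct [a, b, c, d, e]\<close> by (simp add: add.assoc)
    qed
    \<comment> \<open>The added terms have a repeated column. With them all of \<open>z\<close>
      occurs, and expansion along the first column leaves combinations of the
      \<open>?r i\<close>.\<close>
    have "z a * det4 A a c d e + z b * det4 A b c d e
      = z a * det4 A a c d e + z b * det4 A b c d e + z c * det4 A c c d e
        + z d * det4 A d c d e + z e * det4 A e c d e"
      by (simp add: det4_repeated)
    also have "\<dots> = det3 A 1 2 3 c d e * ?r 0 - det3 A 0 2 3 c d e * ?r 1
        + det3 A 0 1 3 c d e * ?r 2 - det3 A 0 1 2 c d e * ?r 3"
      unfolding det4_col by (simp add: algebra_simps)
    finally show ?thesis using r[of 0] r[of 1] r[of 2] r[of 3] by (simp add: eq_neg_iff_add_eq_0)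
  qed
  have swap: "det4 A 1 0 c d = - det4 A 0 1 c d" "det4 A 2 0 c d = - det4 A 0 2 c d"
    "det4 A 3 0 c d = - det4 A 0 3 c d" "det4 A 4 0 c d = - det4 A 0 4 c d"
    "det4 A 2 1 c d = - det4 A 1 2 c d" "det4 A 3 1 c d = - det4 A 1 3 c d" "det4 A 4 1 c d = - det4 A 1 4 c d"
    "det4 A a 2 1 d = - det4 A a 1 2 d" "det4 A a 3 1 d = - det4 A a 1 3 d" "det4 A a 4 1 d = - det4 A a 1 4 d"
    "det4 A a 3 2 d = - det4 A a 2 3 d" "det4 A a 4 2 d = - det4 A a 2 4 d"
    "det4 A a b 3 2 = - det4 A a b 2 3" "det4 A a b 4 2 = - det4 A a b 2 4" "det4 A a b 4 3 = - det4 A a b 3 4"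
    for a b c d
    by (rule det4_alternating)+
  have *: "z 0 * max_minor A 1 = z 1 * max_minor A 0" "z 0 * max_minor A 2 = z 2 * max_minor A 0"
    "z 0 * max_minor A 3 = z 3 * max_minor A 0" "z 0 * max_minor A 4 = z 4 * max_minor A 0"
    "z 1 * max_minor A 2 = z 2 * max_minor A 1" "z 1 * max_minor A 3 = z 3 * max_minor A 1"
    "z 1 * max_minor A 4 = z 4 * max_minor A 1" "z 2 * max_minor A 3 = z 3 * max_minor A 2"
    "z 2 * max_minor A 4 = z 4 * max_minor A 2" "z 3 * max_minor A 4 = z 4 * max_minor A 3"
    using cramer[of 0 1 2 3 4] cramer[of 0 2 1 3 4] cramer[of 0 3 1 2 4] cramer[of 0 4 1 2 3]
      cramer[of 2 1 0 3 4, symmetric] cramer[of 1 3 0 2 4] cramer[of 4 1 0 2 3, symmetric]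
      cramer[of 2 3 0 1 4] cramer[of 2 4 0 1 3] cramer[of 4 3 0 1 2, symmetric]
    by (simp_all add: max_minor_def swap lessThan_5 insert_commute del: One_nat_def)
  show ?thesis
    using less_5_cases[OF assms(2)] less_5_cases[OF assms(3)] * by (elim disjE) simp_all
qed

section \<open>Density of open subsets of the quartic\<close>

text \<open>The fibres of the quartic over the first four coordinates are biquadratic in
  \<open>z = x 4 - x 5\<close>.\<close>

definition fibre_point :: "(nat \<Rightarrow> complex) \<Rightarrow> complex \<Rightarrow> nat \<Rightarrow> complex" where
  "fibre_point y z i = (if i < 4 then y i else if i = 4 then (z - (\<Sum>j<4. y j)) / 2
     else if i = 5 then (- z - (\<Sum>j<4. y j)) / 2 else 0)"

text \<open>Coefficient of the fibre polynomial after division by its leading coefficient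
  \<open>1/8 - t/4\<close>; an inverse constant keeps it within the rules for
  \<open>polyfun\<close>.\<close>

definition fibre_b :: "complex \<Rightarrow> (nat \<Rightarrow> complex) \<Rightarrow> complex" where
  "fibre_b t y = (3/4 * (\<Sum>j<4. y j)^2 - t * ((\<Sum>j<4. y j ^ 2) + 1/2 * (\<Sum>j<4. y j)^2)) * inverse (1/8 - t/4)"

definition fibre_c :: "complex \<Rightarrow> (nat \<Rightarrow> complex) \<Rightarrow> complex" where
  "fibre_c t y = ((\<Sum>j<4. y j ^ 4) + 1/8 * (\<Sum>j<4. y j)^4
     - t * ((\<Sum>j<4. y j ^ 2) + 1/2 * (\<Sum>j<4. y j)^2)^2) * inverse (1/8 - t/4)"

lemma fibre_b_polyfun: "fibre_b t \<in> polyfun 4"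
  unfolding fibre_b_def by (intro polyfun_intros) auto

lemma fibre_c_polyfun: "fibre_c t \<in> polyfun 4"
  unfolding fibre_c_def by (intro polyfun_intros) auto

lemma fibre_point_surj:
  assumes "x \<in> cspace 6" "(\<Sum>i<6. x i) = 0"
  shows "fibre_point x (x 4 - x 5) = x"
proof
  fix i
  have "x 4 + x 5 = - (\<Sum>j<4. x j)"
    using assms(2) by (simp add: sum_less_6 sum_less_4 add_eq_0_iff algebra_simps)
  then have "(\<Sum>j<4. x j) = - (x 4 + x 5)" by simp
  then show "fibre_point x (x 4 - x 5) i = x i"
    using assms(1) by (auto simp: fibre_point_def cspace_def)
qed

text \<open>Exchanging \<open>x 4\<close> and \<open>x 5\<close> negates \<open>z\<close>, so only
  even powers occur. The coefficient of \<open>z^4\<close> is \<open>1/8 - t/4\<close>, nonzero for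
  \<open>t \<noteq> 1/2\<close>.\<close>

lemma fibre_point_in_quartic_cone:
  assumes "t \<noteq> 1/2"
  shows "fibre_point y z \<in> quartic_cone t \<longleftrightarrow> z^4 + fibre_b t y * z^2 + fibre_c t y = 0"
proof -
  let ?x = "fibre_point y z" and ?s = "\<Sum>j<4. y j"
  have x: "?x 0 = y 0" "?x 1 = y 1" "?x 2 = y 2" "?x 3 = y 3" "?x 4 = (z - ?s) / 2" "?x 5 = (- z - ?s) / 2"
    by (simp_all add: fibre_point_def)
  have lead: "1/8 - t/4 \<noteq> 0"
    using assms by (auto simp: field_simps)
  have "?x \<in> cspace 6"
    by (simp add: cspace_def fibre_point_def)
  moreover have "(\<Sum>i<6. ?x i) = 0"
    unfolding sum_less_6 x by (simp add: sum_less_4 field_simps)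
  moreover have "(\<Sum>i<6. ?x i ^ 4) - t * (\<Sum>i<6. ?x i ^ 2)^2
      = (1/8 - t/4) * (z^4 + fibre_b t y * z^2 + fibre_c t y)"
  proof -
    have 4: "(\<Sum>i<6. ?x i ^ 4) = (\<Sum>j<4. y j ^ 4) + (?s^4 + 6 * ?s^2 * z^2 + z^4) / 8"
      unfolding sum_less_6 x sum_less_4[of "\<lambda>j. y j ^ 4"]
      by (simp add: field_simps power4_eq_xxxx power2_eq_square)
    have 2: "(\<Sum>i<6. ?x i ^ 2) = (\<Sum>j<4. y j ^ 2) + (?s^2 + z^2) / 2"
      unfolding sum_less_6 x sum_less_4[of "\<lambda>j. y j ^ 2"]
      by (simp add: field_simps power2_eq_square)
    have "(1/8 - t/4) * fibre_b t y = 3/4 * ?s^2 - t * ((\<Sum>j<4. y j ^ 2) + 1/2 * ?s^2)"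
      "(1/8 - t/4) * fibre_c t y = (\<Sum>j<4. y j ^ 4) + 1/8 * ?s^4 - t * ((\<Sum>j<4. y j ^ 2) + 1/2 * ?s^2)^2"
      using lead by (simp_all add: fibre_b_def fibre_c_def)
    then have rhs: "(1/8 - t/4) * (z^4 + fibre_b t y * z^2 + fibre_c t y)
      = (1/8 - t/4) * z^4 + (3/4 * ?s^2 - t * ((\<Sum>j<4. y j ^ 2) + 1/2 * ?s^2)) * z^2
        + ((\<Sum>j<4. y j ^ 4) + 1/8 * ?s^4 - t * ((\<Sum>j<4. y j ^ 2) + 1/2 * ?s^2)^2)"
      unfolding distrib_left mult.assoc[symmetric] by simp
    show ?thesis
      unfolding 4 2 rhs by (simp add: field_simps power4_eq_xxxx power2_eq_square)
  qed
  ultimately show ?thesis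
    using lead by (auto simp: quartic_cone_def)
qed

text \<open>Division by the fibre polynomial: it is monic in \<open>z\<close>, so the remainder has
  coefficients polynomial in \<open>y\<close>.\<close>

lemma fibre_reduce:
  assumes "f \<in> polyfun 6" and B: "B \<in> polyfun 4" and C: "C \<in> polyfun 4"
  shows "\<exists>r. (\<forall>k. r k \<in> polyfun 4) \<and> (\<forall>y z. z^4 + B y * z^2 + C y = 0 \<longrightarrow>
      f (fibre_point y z) = r 0 y + r 1 y * z + r 2 y * z^2 + r (3::nat) y * z^3)"
  using assms(1)
proof induction
  case (const c)
  show ?case
    by (rule exI[of _ "(\<lambda>_ _. 0)(0 := \<lambda>_. c)"]) (simp add: polyfun.const)
next
  case (var i)
  have s: "(\<lambda>y. - (1/2) * (\<Sum>j<4. y j)) \<in> polyfun 4"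
    by (intro polyfun_intros) auto
  consider "i < 4" | "i = 4" | "i = 5" using var by linarith
  then show ?case
  proof cases
    case 1
    then show ?thesis
      by (intro exI[of _ "(\<lambda>_ _. 0)(0 := \<lambda>y. y i)"])
        (simp add: fibre_point_def polyfun.const polyfun.var)
  next
    case 2
    then show ?thesis
      using s by (intro exI[of _ "(\<lambda>_ _. 0)(0 := \<lambda>y. - (1/2) * (\<Sum>j<4. y j), 1 := \<lambda>_. 1/2)"])
        (simp add: fibre_point_def polyfun.const field_simps)
  next
    case 3
    then show ?thesis
      using s by (intro exI[of _ "(\<lambda>_ _. 0)(0 := \<lambda>y. - (1/2) * (\<Sum>j<4. y j), 1 := \<lambda>_. - (1/2))"])
        (simp add: fibre_point_def polyfun.const field_simps)
  qed
next
  case (add f g)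
  then obtain r q where r: "\<And>k::nat. r k \<in> polyfun 4" and q: "\<And>k::nat. q k \<in> polyfun 4"
    and f: "\<And>y z. z^4 + B y * z^2 + C y = 0 \<Longrightarrow> f (fibre_point y z) = r 0 y + r 1 y * z + r 2 y * z^2 + r 3 y * z^3"
    and g: "\<And>y z. z^4 + B y * z^2 + C y = 0 \<Longrightarrow> g (fibre_point y z) = q 0 y + q 1 y * z + q 2 y * z^2 + q 3 y * z^3"
    by blast
  show ?case
    by (rule exI[of _ "\<lambda>k y. r k y + q k y"]) (simp add: f g r q polyfun.add algebra_simps)
next
  case (mult f g)
  then obtain r q where r: "\<And>k::nat. r k \<in> polyfun 4" and q: "\<And>k::nat. q k \<in> polyfun 4"
    and f: "\<And>y z. z^4 + B y * z^2 + C y = 0 \<Longrightarrow> f (fibre_point y z) = r 0 y + r 1 y * z + r 2 y * z^2 + r 3 y * z^3"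
    and g: "\<And>y z. z^4 + B y * z^2 + C y = 0 \<Longrightarrow> g (fibre_point y z) = q 0 y + q 1 y * z + q 2 y * z^2 + q 3 y * z^3"
    by blast
  \<comment> \<open>Coefficients of \<open>z^4\<close>, \<open>z^5\<close>, \<open>z^6\<close> in
    the product of the two remainders.\<close>
  define c4 where "c4 = (\<lambda>y. r 1 y * q 3 y + r 2 y * q 2 y + r 3 y * q 1 y)"
  define c5 where "c5 = (\<lambda>y. r 2 y * q 3 y + r 3 y * q 2 y)"
  define c6 where "c6 = (\<lambda>y. r 3 y * q 3 y)"
  have c: "c4 \<in> polyfun 4" "c5 \<in> polyfun 4" "c6 \<in> polyfun 4"
    unfolding c4_def c5_def c6_def by (intro polyfun_intros r q)+
  \<comment> \<open>The new remainder, from \<open>z^4 = - B z^2 - C\<close> and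
    \<open>z^6 = (B^2 - C) z^2 + B C\<close>; the quotient is
    \<open>c4 + c5 z + c6 (z^2 - B)\<close>.\<close>
  define d0 where "d0 = (\<lambda>y. r 0 y * q 0 y - c4 y * C y + c6 y * B y * C y)"
  define d1 where "d1 = (\<lambda>y. r 0 y * q 1 y + r 1 y * q 0 y - c5 y * C y)"
  define d2 where "d2 = (\<lambda>y. r 0 y * q 2 y + r 1 y * q 1 y + r 2 y * q 0 y - c4 y * B y + c6 y * (B y ^ 2 - C y))"
  define d3 where "d3 = (\<lambda>y. r 0 y * q 3 y + r 1 y * q 2 y + r 2 y * q 1 y + r 3 y * q 0 y - c5 y * B y)"
  have d: "d0 \<in> polyfun 4" "d1 \<in> polyfun 4" "d2 \<in> polyfun 4" "d3 \<in> polyfun 4"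
    unfolding d0_def d1_def d2_def d3_def by (intro polyfun_intros r q c B C)+
  have "f (fibre_point y z) * g (fibre_point y z) = d0 y + d1 y * z + d2 y * z^2 + d3 y * z^3"
    if z: "z^4 + B y * z^2 + C y = 0" for y z
  proof -
    have "f (fibre_point y z) * g (fibre_point y z)
      = (r 0 y + r 1 y * z + r 2 y * z^2 + r 3 y * z^3) * (q 0 y + q 1 y * z + q 2 y * z^2 + q 3 y * z^3)"
      unfolding f[OF z] g[OF z] ..
    also have "\<dots> = d0 y + d1 y * z + d2 y * z^2 + d3 y * z^3
      + (c4 y + c5 y * z + c6 y * (z^2 - B y)) * (z^4 + B y * z^2 + C y)"
      unfolding d0_def d1_def d2_def d3_def c4_def c5_def c6_def
      by (simp add: algebra_simps eval_nat_numeral)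
    finally show ?thesis
      using z by simp
  qed
  then show ?case
    using d by (intro exI[of _ "(\<lambda>_ _. 0)(0 := d0, 1 := d1, 2 := d2, 3 := d3)"])
      (simp add: polyfun.const)
qed

text \<open>\<open>h\<close> is the norm of \<open>f\<close> with respect to the projection to the first four coordinates.\<close>

lemma fibre_norm:
  assumes f: "f \<in> polyfun 6" and B: "B \<in> polyfun 4" and C: "C \<in> polyfun 4"
  obtains h where "h \<in> polyfun 4"
    "\<And>y z. z^4 + B y * z^2 + C y = 0 \<Longrightarrow> f (fibre_point y z) = 0 \<Longrightarrow> h y = 0"
    "\<And>y. B y = 0 \<Longrightarrow> C y = 0 \<Longrightarrow> h y = f (fibre_point y 0) ^ 4"
proof -
  obtain r where r: "\<And>k::nat. r k \<in> polyfun 4"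
    and eq: "\<And>y z. z^4 + B y * z^2 + C y = 0 \<Longrightarrow> f (fibre_point y z) = r 0 y + r 1 y * z + r 2 y * z^2 + r 3 y * z^3"
    using fibre_reduce[OF assms] by blast
  \<comment> \<open>\<open>q0 + q1 z^2\<close> is the product of the remainder's values at
    \<open>z\<close> and \<open>- z\<close>, reduced by the fibre polynomial.\<close>
  define q0 where "q0 = (\<lambda>y. r 0 y ^ 2 - r 2 y ^ 2 * C y + 2 * r 1 y * r 3 y * C y - r 3 y ^ 2 * B y * C y)"
  define q1 where "q1 = (\<lambda>y. 2 * r 0 y * r 2 y - r 2 y ^ 2 * B y - r 1 y ^ 2 + 2 * r 1 y * r 3 y * B y
    - r 3 y ^ 2 * (B y ^ 2 - C y))"
  \<comment> \<open>The product of \<open>q0 + q1 Z\<close> over both roots of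
    \<open>Z^2 + B Z + C\<close>; the root besides \<open>Z\<close> is
    \<open>- B - Z\<close>.\<close>
  define h where "h = (\<lambda>y. q0 y ^ 2 - q0 y * q1 y * B y + q1 y ^ 2 * C y)"
  have q: "q0 \<in> polyfun 4" "q1 \<in> polyfun 4"
    unfolding q0_def q1_def by (intro polyfun_intros r B C)+
  show thesis
  proof
    show "h \<in> polyfun 4"
      unfolding h_def by (intro polyfun_intros q B C)
  next
    fix y z assume z: "z^4 + B y * z^2 + C y = 0" and f0: "f (fibre_point y z) = 0"
    have 0: "r 0 y + r 1 y * z + r 2 y * z^2 + r 3 y * z^3 = 0"
      using f0 eq[OF z] by simp
    have "q0 y + q1 y * z^2 = (r 0 y + r 1 y * z + r 2 y * z^2 + r 3 y * z^3) * (r 0 y - r 1 y * z + r 2 y * z^2 - r 3 y * z^3)"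
    proof -
      have "(r 0 y + r 1 y * z + r 2 y * z^2 + r 3 y * z^3) * (r 0 y - r 1 y * z + r 2 y * z^2 - r 3 y * z^3)
        = q0 y + q1 y * z^2 + (r 2 y ^ 2 - 2 * r 1 y * r 3 y - r 3 y ^ 2 * (z^2 - B y)) * (z^4 + B y * z^2 + C y)"
        unfolding q0_def q1_def by (simp add: algebra_simps eval_nat_numeral)
      then show ?thesis using z by simp
    qed
    then have "q0 y + q1 y * z^2 = 0"
      using 0 by simp
    moreover have "h y = (q0 y + q1 y * z^2) * (q0 y - q1 y * B y - q1 y * z^2)"
    proof -
      have "h y = (q0 y + q1 y * z^2) * (q0 y - q1 y * B y - q1 y * z^2)
          + q1 y ^ 2 * (z^4 + B y * z^2 + C y)"
        unfolding h_def by (simp add: algebra_simps eval_nat_numeral)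
      then show ?thesis using z by simp
    qed
    ultimately show "h y = 0" by simp
  next
    \<comment> \<open>Here \<open>z = 0\<close> is a fourfold root, so the norm is a fourth
      power.\<close>
    fix y assume "B y = 0" "C y = 0"
    then show "h y = f (fibre_point y 0) ^ 4"
      using eq[of 0 y] by (simp add: h_def q0_def flip: power_mult)
  qed
qed

text \<open>Continuity of roots: the root closest to \<open>w\<close>.\<close>

lemma biquadratic_root_near:
  fixes b c w :: complex
  obtains z where "z^4 + b * z^2 + c = 0" "norm (w - z) ^ 4 \<le> norm (w^4 + b * w^2 + c)"
proof -
  define d where "d = csqrt (b^2 - 4 * c)"
  define r where "r = csqrt ((- b + d) / 2)"
  define s where "s = csqrt ((- b - d) / 2)"
  have d2: "d^2 = b^2 - 4 * c" and r2: "r^2 = (- b + d) / 2" and s2: "s^2 = (- b - d) / 2"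
    by (simp_all add: d_def r_def s_def)
  have squares: "z^4 + b * z^2 + c = (z^2 - r^2) * (z^2 - s^2)" for z
  proof -
    have "(z^2 - r^2) * (z^2 - s^2) = z^4 + b * z^2 + (b^2 - d^2) / 4"
      unfolding r2 s2 by (simp add: field_simps power4_eq_xxxx power2_eq_square)
    then show ?thesis unfolding d2 by simp
  qed
  have fact: "z^4 + b * z^2 + c = (z - r) * (z - (- r)) * (z - s) * (z - (- s))" for z
    unfolding squares by (simp add: algebra_simps power2_eq_square)
  define R where "R = {r, - r, s, - s}"
  have R: "finite R" "R \<noteq> {}"
    by (simp_all add: R_def)
  define z where "z = arg_min_on (\<lambda>z. norm (w - z)) R"
  have z: "z \<in> R" "\<And>z'. z' \<in> R \<Longrightarrow> norm (w - z) \<le> norm (w - z')"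
    unfolding z_def by (rule arg_min_if_finite(1)[OF R], rule arg_min_least[OF R])
  have "z^4 + b * z^2 + c = 0"
    using z(1) unfolding fact R_def by auto
  \<comment> \<open>Each of the four linear factors at \<open>w\<close> has norm at least
    \<open>norm (w - z)\<close>.\<close>
  moreover have "norm (w - z) ^ 4 \<le> norm (w^4 + b * w^2 + c)"
    unfolding fact norm_mult power4_eq_xxxx[of "norm (w - z)"]
    by (intro mult_mono z(2)) (auto simp: R_def)
  ultimately show thesis
    using that by blast
qed

text \<open>A line from \<open>y0\<close> to the first coordinates of \<open>x\<close> lifts to
  points of the quartic tending to \<open>x\<close>. The norm of \<open>g\<close> is nonzero at
  \<open>y0\<close>, hence at all but finitely many parameters; there \<open>f\<close> vanishes, and
  so does its limit.\<close>

lemma quartic_cone_dense: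
  assumes t: "t \<noteq> 1/2" and f: "f \<in> polyfun 6" and g: "g \<in> polyfun 6"
    and fg: "\<And>x. x \<in> quartic_cone t \<Longrightarrow> g x \<noteq> 0 \<Longrightarrow> f x = 0"
    and y0: "fibre_b t y0 = 0" "fibre_c t y0 = 0" "g (fibre_point y0 0) \<noteq> 0"
    and x: "x \<in> quartic_cone t"
  shows "f x = 0"
proof -
  obtain h where h: "h \<in> polyfun 4"
    and h0: "\<And>y z. z^4 + fibre_b t y * z^2 + fibre_c t y = 0 \<Longrightarrow> g (fibre_point y z) = 0 \<Longrightarrow> h y = 0"
    and hy0: "h y0 \<noteq> 0"
    using fibre_norm[OF g fibre_b_polyfun[of t] fibre_c_polyfun[of t]] y0 by (metis power_not_zero)
  define y where "y s i = y0 i + s * (x i - y0 i)" for s i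
  define w where "w = x 4 - x 5"
  have xw: "fibre_point x w = x"
    using x by (auto simp: w_def quartic_cone_def intro: fibre_point_surj)
  \<comment> \<open>The fibre polynomial over \<open>y s\<close>, evaluated at \<open>w\<close>. It
    tends to 0 as \<open>s\<close> tends to 1, which forces the nearest root \<open>z s\<close>
    towards \<open>w\<close>.\<close>
  define P where "P s = w^4 + fibre_b t (y s) * w^2 + fibre_c t (y s)" for s
  have "\<exists>z. z^4 + fibre_b t (y s) * z^2 + fibre_c t (y s) = 0 \<and> norm (w - z) ^ 4 \<le> norm (P s)" for s
    unfolding P_def by (rule biquadratic_root_near) blast
  then obtain z where z: "\<And>s. z s ^ 4 + fibre_b t (y s) * z s ^ 2 + fibre_c t (y s) = 0"
    and zw: "\<And>s. norm (w - z s) ^ 4 \<le> norm (P s)"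
    by metis
  have ylim: "((\<lambda>s. y s i) \<longlongrightarrow> x i) (at 1)" for i
    unfolding y_def by (auto intro!: tendsto_eq_intros)
  have "P 1 = 0"
    using x fibre_point_in_quartic_cone[OF t, of x w] unfolding xw P_def y_def by simp
  moreover have "y 1 = x"
    by (simp add: y_def fun_eq_iff)
  ultimately have Px: "w^4 + fibre_b t x * w^2 + fibre_c t x = 0"
    unfolding P_def by simp
  have "((\<lambda>s. fibre_b t (y s)) \<longlongrightarrow> fibre_b t x) (at 1)"
    by (rule polyfun_tendsto[OF fibre_b_polyfun ylim])
  moreover have "((\<lambda>s. fibre_c t (y s)) \<longlongrightarrow> fibre_c t x) (at 1)"
    by (rule polyfun_tendsto[OF fibre_c_polyfun ylim])
  ultimately have "(P \<longlongrightarrow> w^4 + fibre_b t x * w^2 + fibre_c t x) (at 1)"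
    unfolding P_def
    by (intro tendsto_add tendsto_mult tendsto_const)
  then have norm_P: "((\<lambda>s. norm (P s)) \<longlongrightarrow> 0) (at 1)"
    unfolding Px by (rule tendsto_norm_zero)
  have "((\<lambda>s. norm (w - z s) ^ 4) \<longlongrightarrow> 0) (at 1)"
    by (rule tendsto_sandwich[OF _ _ tendsto_const norm_P]) (simp_all add: zw)
  then have "((\<lambda>s. root 4 (norm (w - z s) ^ 4)) \<longlongrightarrow> root 4 0) (at 1)"
    by (rule tendsto_real_root)
  then have "((\<lambda>s. w - z s) \<longlongrightarrow> 0) (at 1)"
    by (simp add: real_root_power_cancel tendsto_norm_zero_iff)
  then have "((\<lambda>s. w - (w - z s)) \<longlongrightarrow> w - 0) (at 1)"
    by (intro tendsto_intros)
  then have zlim: "(z \<longlongrightarrow> w) (at 1)"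
    by simp
  have "((\<lambda>s. f (fibre_point (y s) (z s))) \<longlongrightarrow> f (fibre_point x w)) (at 1)"
  proof (rule polyfun_tendsto[OF f])
    fix i
    show "((\<lambda>s. fibre_point (y s) (z s) i) \<longlongrightarrow> fibre_point x w i) (at 1)"
      unfolding fibre_point_def by (auto intro!: tendsto_intros ylim zlim)
  qed
  moreover have "((\<lambda>s. f (fibre_point (y s) (z s))) \<longlongrightarrow> 0) (at 1)"
  proof (rule tendsto_eventually)
    obtain p where p: "\<And>s. h (y s) = poly p s"
      using polyfun_line[OF h, of y0 "\<lambda>i. x i - y0 i"] unfolding y_def by blast
    have "y 0 = y0"
      by (simp add: y_def fun_eq_iff)
    \<comment> \<open>Along the line the norm of \<open>g\<close> is a nonzero polynomial, so its
      roots other than 1 keep a distance from 1.\<close>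
    then have "p \<noteq> 0"
      using hy0 p[of 0] by auto
    then have "eventually (\<lambda>s. poly p s \<noteq> 0) (at 1)"
      using finite_imp_closed[OF finite_subset[OF _ poly_roots_finite[of p]], of "{s. poly p s = 0} - {1}"]
      by (auto simp: eventually_at_topological intro!: exI[of _ "- ({s. poly p s = 0} - {1})"])
    then show "eventually (\<lambda>s. f (fibre_point (y s) (z s)) = 0) (at 1)"
    proof eventually_elim
      case (elim s)
      then have "g (fibre_point (y s) (z s)) \<noteq> 0"
        using h0[OF z] p by auto
      then show ?case
        using fg fibre_point_in_quartic_cone[OF t] z by blast
    qed
  qed
  ultimately show ?thesis
    unfolding xw by (rule tendsto_unique[rotated -2]) simp
qed

section \<open>Determinantal quartics\<close>

lemma polyfun_det3:
  assumes "\<And>i j. (\<lambda>x. A x i j) \<in> polyfun n"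
  shows "(\<lambda>x. det3 (A x) i j k a b c) \<in> polyfun n"
  unfolding det3_def by (intro polyfun_intros assms)

lemma polyfun_det4:
  assumes "\<And>i j. (\<lambda>x. A x i j) \<in> polyfun n"
  shows "(\<lambda>x. det4 (A x) a b c d) \<in> polyfun n"
  unfolding det4_def by (intro polyfun_intros polyfun_det3 assms)

lemma det3_scale: "det3 (\<lambda>i j. s * A i j) i j k a b c = s ^ 3 * det3 A i j k a b c"
  by (simp add: det3_def algebra_simps power3_eq_cube)

lemma det4_scale: "det4 (\<lambda>i j. s * A i j) a b c d = s ^ 4 * det4 A a b c d"
  unfolding det4_def det3_scale by (simp add: algebra_simps power4_eq_xxxx power3_eq_cube)

text \<open>A tensor \<open>c\<close> is read as the matrix \<open>M x\<close> of linear forms on the hyperplane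
  \<open>\<Sum>i<6. x i = 0\<close>, and as the matrix \<open>N y\<close> of linear forms with
  \<open>M x \<cdot> y = N y \<cdot> x\<close>, where the coordinate \<open>x 5\<close> has been eliminated.\<close>

definition matM :: "(nat \<Rightarrow> nat \<Rightarrow> nat \<Rightarrow> complex) \<Rightarrow> (nat \<Rightarrow> complex) \<Rightarrow> nat \<Rightarrow> nat \<Rightarrow> complex" where
  "matM c x i j = (\<Sum>l<6. c i j l * x l)"

definition matN :: "(nat \<Rightarrow> nat \<Rightarrow> nat \<Rightarrow> complex) \<Rightarrow> (nat \<Rightarrow> complex) \<Rightarrow> nat \<Rightarrow> nat \<Rightarrow> complex" where
  "matN c y i l = (\<Sum>j<4. (c i j l - c i j 5) * y j)"

definition kerM :: "(nat \<Rightarrow> nat \<Rightarrow> nat \<Rightarrow> complex) \<Rightarrow> (nat \<Rightarrow> complex) \<Rightarrow> nat \<Rightarrow> complex" where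
  "kerM c x j = (if j < 4 then row0_cofactor (matM c x) j else 0)"

text \<open>The eliminated coordinate is restored so that the value lies in the hyperplane.\<close>

definition kerN :: "(nat \<Rightarrow> nat \<Rightarrow> nat \<Rightarrow> complex) \<Rightarrow> (nat \<Rightarrow> complex) \<Rightarrow> nat \<Rightarrow> complex" where
  "kerN c y i = (if i < 5 then max_minor (matN c y) i
     else if i = 5 then - (\<Sum>l<5. max_minor (matN c y) l) else 0)"

lemma matM_matN:
  assumes "(\<Sum>i<6. x i) = 0"
  shows "(\<Sum>j<4. matM c x i j * y j) = (\<Sum>l<5. matN c y i l * x l)"
proof -
  have x5: "x 5 = - (x 0 + x 1 + x 2 + x 3 + x 4)"
    using assms by (simp add: sum_less_6 add_eq_0_iff add.commute)
  show ?thesis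
    unfolding matM_def matN_def sum_less_4 sum_less_5 sum_less_6 x5 by (simp add: algebra_simps)
qed

lemma matM_scale: "matM c (\<lambda>i. s * x i) = (\<lambda>i j. s * matM c x i j)"
  by (simp add: matM_def fun_eq_iff sum_distrib_left mult.left_commute)

lemma matN_scale: "matN c (\<lambda>i. s * y i) = (\<lambda>i j. s * matN c y i j)"
  by (simp add: matN_def fun_eq_iff sum_distrib_left mult.left_commute)

lemma kerM_scale: "kerM c (\<lambda>i. s * x i) j = s ^ 3 * kerM c x j"
  by (simp add: kerM_def row0_cofactor_def matM_scale det3_scale)

lemma kerN_scale: "kerN c (\<lambda>i. s * y i) j = s ^ 4 * kerN c y j"
proof -
  have "max_minor (matN c (\<lambda>i. s * y i)) l = s ^ 4 * max_minor (matN c y) l" for l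
    by (simp add: max_minor_def matN_scale det4_scale)
  then show ?thesis
    by (simp add: kerN_def sum_distrib_left)
qed

lemma kerM_homog: "homog 6 3 (\<lambda>x. kerM c x j)"
proof -
  have "(\<lambda>x. matM c x i j) \<in> polyfun 6" for i j
    unfolding matM_def by (intro polyfun_intros) auto
  note * = polyfun_det3[OF this]
  have "(\<lambda>x. kerM c x j) \<in> polyfun 6"
    unfolding kerM_def row0_cofactor_def
    by (cases "j < 4"; cases "j = 0"; cases "j = 1"; cases "j = 2")
      (simp_all add: * polyfun.const polyfun_uminus)
  then show ?thesis
    by (simp add: homog_def kerM_scale)
qed

lemma kerN_homog: "homog 4 4 (\<lambda>y. kerN c y i)"
proof -
  have "(\<lambda>y. matN c y i j) \<in> polyfun 4" for i j
    unfolding matN_def by (intro polyfun_intros) auto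
  note * = polyfun_det4[OF this]
  have mm: "(\<lambda>y. max_minor (matN c y) i) \<in> polyfun 4" for i
    unfolding max_minor_def
    by (cases "i = 0"; cases "i = 1"; cases "i = 2"; cases "i = 3")
      (simp_all add: * polyfun_uminus)
  have "(\<lambda>y. kerN c y i) \<in> polyfun 4"
    unfolding kerN_def
    by (cases "i < 5"; cases "i = 5") (simp_all add: mm polyfun.const polyfun_uminus polyfun_sum)
  then show ?thesis
    by (simp add: homog_def kerN_scale)
qed

lemma matM_kerM:
  assumes "det4 (matM c x) 0 1 2 3 = 0" "i < 4"
  shows "(\<Sum>j<4. matM c x i j * kerM c x j) = 0"
  using row0_cofactor_expand[OF assms(2), of "matM c x"] assms(1) by (simp add: kerM_def)

lemma kerN_sum: "(\<Sum>i<6. kerN c y i) = 0"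
  by (simp add: sum_less_6 sum_less_5 kerN_def)

lemma kerN_cspace: "kerN c y \<in> cspace 6"
  by (simp add: cspace_def kerN_def)

lemma matM_kerN:
  assumes "i < 4"
  shows "(\<Sum>j<4. matM c (kerN c y) i j * y j) = 0"
  using max_minor_expand[OF assms, of "matN c y"]
  by (simp add: matM_matN[OF kerN_sum] kerN_def)

text \<open>\<open>matM c (kerN c y)\<close> annihilates \<open>y\<close>, so it is singular when
  \<open>y\<close> has a nonzero entry among the first four; otherwise it is the zero
  matrix.\<close>

lemma det_matM_kerN: "det4 (matM c (kerN c y)) 0 1 2 3 = 0"
proof (cases "\<exists>a<4. y a \<noteq> 0")
  case True
  then obtain a where a: "a < 4" "y a \<noteq> 0" by blast
  let ?A = "matM c (kerN c y)"
  have row: "det4 ?A 0 1 2 3 = (\<Sum>j<4. ?A 0 j * row0_cofactor ?A j)"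
    using row0_cofactor_expand[of 0 ?A] by simp
  have "y a * det4 ?A 0 1 2 3 = (\<Sum>j<4. ?A 0 j * (y a * row0_cofactor ?A j))"
    unfolding row by (simp add: sum_distrib_left mult.left_commute)
  \<comment> \<open>Cramer's rule exchanges \<open>a\<close> and \<open>j\<close>, which exposes row
    0 applied to \<open>y\<close>.\<close>
  also have "\<dots> = (\<Sum>j<4. ?A 0 j * y j) * row0_cofactor ?A a"
    unfolding sum_distrib_right
    by (intro sum.cong) (use row0_cofactor_kernel[of ?A y, OF matM_kerN a(1)] in auto)
  also have "\<dots> = 0"
    by (simp add: matM_kerN)
  finally show ?thesis using a by simp
next
  case False
  then have "matN c y = (\<lambda>_ _. 0)"
    by (auto simp: matN_def fun_eq_iff intro!: sum.neutral)
  moreover have "max_minor (\<lambda>_ _. 0 :: complex) l = 0" for l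
    by (simp add: max_minor_def det4_def)
  ultimately have "kerN c y = (\<lambda>_. 0)"
    by (intro ext) (simp add: kerN_def)
  then show ?thesis
    by (simp add: det4_def matM_def)
qed

text \<open>A nonzero maximal minor makes the kernel of \<open>matN c y\<close> one-dimensional, and
  \<open>matM_matN\<close> places \<open>x\<close> in it.\<close>

lemma kerN_unique:
  assumes x: "x \<in> cspace 6" "(\<Sum>i<6. x i) = 0" "x \<noteq> (\<lambda>_. 0)"
    and ker: "\<And>i. i < 4 \<Longrightarrow> (\<Sum>j<4. matM c x i j * y j) = 0"
    and b: "b < 5" "kerN c y b \<noteq> 0"
  obtains k where "k \<noteq> 0" "kerN c y = (\<lambda>i. k * x i)"
proof -
  have cross: "x a * kerN c y b = x b * kerN c y a" if "a < 5" for a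
    using max_minor_kernel[of "matN c y" x, OF _ that b(1)] ker matM_matN[OF x(2)] that b(1)
    by (simp add: kerN_def)
  have x5: "x 5 = - (x 0 + x 1 + x 2 + x 3 + x 4)" "kerN c y 5 = - (kerN c y 0 + kerN c y 1 + kerN c y 2 + kerN c y 3 + kerN c y 4)"
    using x(2) kerN_sum[of c y] by (simp_all add: sum_less_6 add_eq_0_iff add.commute)
  \<comment> \<open>If \<open>x b\<close> were 0, the relations \<open>cross\<close> would make all
    of \<open>x\<close> vanish.\<close>
  have "x b \<noteq> 0"
  proof
    assume "x b = 0"
    then have 0: "x a = 0" if "a < 5" for a
      using cross[OF that] b(2) by simp
    have "x a = 0" for a
    proof -
      consider "a < 5" | "a = 5" | "a \<ge> 6" by linarith
      then show ?thesis
        by cases (use 0 x5 x(1) in \<open>auto simp: cspace_def\<close>)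
    qed
    then show False using x(3) by auto
  qed
  define k where "k = kerN c y b / x b"
  have "k \<noteq> 0"
    using b \<open>x b \<noteq> 0\<close> by (simp add: k_def)
  have k: "kerN c y a = k * x a" if "a < 5" for a
    using cross[OF that] \<open>x b \<noteq> 0\<close> by (simp add: k_def field_simps)
  have "kerN c y a = k * x a" for a
  proof -
    consider "a < 5" | "a = 5" | "a \<ge> 6" by linarith
    then show ?thesis
    proof cases
      case 2
      show ?thesis unfolding 2 x5 by (simp add: k algebra_simps)
    qed (use k x(1) kerN_cspace[of c y] in \<open>auto simp: cspace_def\<close>)
  qed
  with \<open>k \<noteq> 0\<close> show thesis
    using that by blast
qed

lemma kerM_unique:
  assumes y: "y \<in> cspace 4" "y \<noteq> (\<lambda>_. 0)"
    and ker: "\<And>i. i < 4 \<Longrightarrow> (\<Sum>j<4. matM c x i j * y j) = 0"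
    and a: "kerM c x a \<noteq> 0"
  obtains k where "k \<noteq> 0" "kerM c x = (\<lambda>i. k * y i)"
proof -
  have a4: "a < 4"
    using a by (auto simp: kerM_def split: if_splits)
  have cross: "y j * kerM c x a = y a * kerM c x j" for j
    using row0_cofactor_kernel[of "matM c x" y j a, OF ker _ a4] a4 y(1)
    by (cases "j < 4") (auto simp: kerM_def cspace_def)
  have "y a \<noteq> 0"
    using cross a y(2) by (auto simp: fun_eq_iff)
  then have "kerM c x j = kerM c x a / y a * y j" for j
    using cross[of j] by (simp add: field_simps)
  moreover have "kerM c x a / y a \<noteq> 0"
    using a \<open>y a \<noteq> 0\<close> by simp
  ultimately show thesis
    using that[of "kerM c x a / y a"] by blast
qed

section \<open>Rationality from a determinantal representation\<close>

lemma proj_alg_set_quartic_cone: "proj_alg_set 5 (quartic_cone t)"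
proof -
  let ?l = "\<lambda>x :: nat \<Rightarrow> complex. \<Sum>i<6. x i"
  let ?q = "\<lambda>x :: nat \<Rightarrow> complex. (\<Sum>i<6. x i ^ 4) - t * (\<Sum>i<6. x i ^ 2) ^ 2"
  have "?l \<in> polyfun 6"
    by (intro polyfun_intros) auto
  then have "homog (Suc 5) 1 ?l"
    by (simp add: homog_def sum_distrib_left)
  moreover have "?q \<in> polyfun 6"
    by (intro polyfun_intros) auto
  then have "homog (Suc 5) 4 ?q"
    by (simp add: homog_def power_mult_distrib right_diff_distrib flip: sum_distrib_left power_mult)
  ultimately show ?thesis
    unfolding proj_alg_set_def
    by (intro exI[of _ "{?l, ?q}"]) (auto simp: quartic_cone_def)
qed

text \<open>The pair \<open>x0\<close>, \<open>y0\<close> certifies that the two rational maps are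
  defined and mutually inverse on nonempty open sets. Over \<open>x0\<close> the fibre polynomial is
  \<open>z^4\<close>, so \<open>x0\<close> also serves as the starting point of the density
  argument.\<close>

theorem rational_determinantal_quartic:
  assumes t: "t \<noteq> 1/2" and \<kappa>: "\<kappa> \<noteq> 0"
    and det: "\<And>x. (\<Sum>i<6. x i) = 0 \<Longrightarrow>
      det4 (matM c x) 0 1 2 3 = \<kappa> * ((\<Sum>i<6. x i ^ 4) - t * (\<Sum>i<6. x i ^ 2) ^ 2)"
    and x0: "x0 \<in> cspace 4" "(\<Sum>i<4. x0 i) = 0" "(\<Sum>i<4. x0 i ^ 2) = 0" "(\<Sum>i<4. x0 i ^ 4) = 0"
    and y0: "y0 \<in> cspace 4" "\<And>i. i < 4 \<Longrightarrow> (\<Sum>j<4. matM c x0 i j * y0 j) = 0"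
    and a: "kerM c x0 a \<noteq> 0" and b: "b < 5" "kerN c y0 b \<noteq> 0"
  shows "rational_proj_variety 5 (quartic_cone t)"
proof -
  let ?C = "quartic_cone t"
  have C_iff: "x \<in> ?C \<longleftrightarrow> x \<in> cspace 6 \<and> (\<Sum>i<6. x i) = 0 \<and> det4 (matM c x) 0 1 2 3 = 0" for x
    using \<kappa> det[of x] by (auto simp: quartic_cone_def)
  have kerN_C: "kerN c y \<in> ?C" for y
    unfolding C_iff using kerN_cspace kerN_sum det_matM_kerN by blast
  have kerM_cspace: "kerM c x \<in> cspace 4" for x
    by (simp add: cspace_def kerM_def)
  have x0_4: "x0 4 = 0" "x0 5 = 0"
    using x0(1) by (auto simp: cspace_def)
  have kerM_0: "kerM c (\<lambda>_. 0) j = 0" for j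
    using homog_zero[OF kerM_homog] by simp
  have kerN_0: "kerN c (\<lambda>_. 0) j = 0" for j
    using homog_zero[OF kerN_homog] by simp
  have x0_C: "x0 \<in> ?C"
    using x0 x0_4 by (auto simp: quartic_cone_def cspace_def sum_less_4 sum_less_6)
  have x0_nz: "x0 \<noteq> (\<lambda>_. 0)"
    using a kerM_0 by auto
  have y0_nz: "y0 \<noteq> (\<lambda>_. 0)"
    using b(2) kerN_0 by auto
  \<comment> \<open>The image of \<open>x0\<close> is a nonzero multiple of \<open>y0\<close>, so
    nonvanishing at \<open>y0\<close> carries over to it.\<close>
  define y1 where "y1 = kerM c x0"
  obtain k where k: "k \<noteq> 0" "y1 = (\<lambda>i. k * y0 i)"
    unfolding y1_def by (rule kerM_unique[OF y0(1) y0_nz y0(2) a])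
  have y1: "kerN c y1 b \<noteq> 0"
    unfolding k(2) kerN_scale using k(1) b(2) by simp

  have kerN_kerM: "\<exists>k. k \<noteq> 0 \<and> kerN c (kerM c x) = (\<lambda>i. k * x i)"
    if x: "x \<in> ?C" and g: "kerN c (kerM c x) b \<noteq> 0" for x
  proof -
    have nz: "x \<noteq> (\<lambda>_. 0)"
    proof
      assume "x = (\<lambda>_. 0)"
      then have "kerM c x = (\<lambda>_. 0)"
        using kerM_0 by auto
      then show False
        using g kerN_0 by simp
    qed
    have x': "x \<in> cspace 6" "(\<Sum>i<6. x i) = 0" "det4 (matM c x) 0 1 2 3 = 0"
      using x unfolding C_iff by auto
    show ?thesis
      by (rule kerN_unique[OF x'(1,2) nz matM_kerM[OF x'(3)] b(1) g]) auto
  qed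
  have kerM_kerN: "\<exists>k. k \<noteq> 0 \<and> kerM c (kerN c y) = (\<lambda>i. k * y i)"
    if y: "y \<in> cspace 4" "y \<noteq> (\<lambda>_. 0)" and h: "kerM c (kerN c y) a \<noteq> 0" for y
    by (rule kerM_unique[OF y matM_kerN h]) auto

  \<comment> \<open>A nonzero coordinate of the composite certifies one-dimensional kernels; the
    degree is \<open>3 * 4 = 12\<close>.\<close>
  define g where "g = (\<lambda>x. kerN c (kerM c x) b)"
  define h where "h = (\<lambda>y. kerM c (kerN c y) a)"
  have g: "homog 6 12 g"
    unfolding g_def
    using homog_compose[where \<phi> = "\<lambda>j x. kerM c x j" and \<psi> = "kerM c",
        OF kerN_homog[of c b] kerM_homog refl] by simp
  have h: "homog 4 12 h"
    unfolding h_def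
    using homog_compose[where \<phi> = "\<lambda>i y. kerN c y i" and \<psi> = "kerN c",
        OF kerM_homog[of c a] kerN_homog refl] by simp
  have g_x0: "g x0 \<noteq> 0"
    using y1 by (simp add: g_def y1_def)
  have h_y1: "h y1 \<noteq> 0"
  proof -
    obtain k where "k \<noteq> 0" "kerN c y1 = (\<lambda>i. k * x0 i)"
      using kerN_kerM[OF x0_C] y1 unfolding y1_def by blast
    then show ?thesis
      unfolding h_def by (simp add: kerM_scale a)
  qed

  have "birational_to_Pn 5 ?C 3"
  proof -
    have pM: "pmap 3 (\<lambda>j x. kerM c x j) = kerM c"
      by (auto simp: pmap_def kerM_def fun_eq_iff)
    have pN: "pmap 5 (\<lambda>j x. kerN c x j) = kerN c"
      by (auto simp: pmap_def kerN_def fun_eq_iff)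
    have proportional_mult: "proportional x y" if "k \<noteq> 0" "y = (\<lambda>i. k * x i)" for x y k
      using that by (auto simp: proportional_def)
    have 1: "kerM c x \<noteq> (\<lambda>_. 0) \<and> proportional x (kerN c (kerM c x))"
      if x: "x \<in> ?C" "g x \<noteq> 0" for x
    proof -
      obtain k where "k \<noteq> 0" "kerN c (kerM c x) = (\<lambda>i. k * x i)"
        using kerN_kerM[OF x(1)] x(2) unfolding g_def by blast
      then show ?thesis
        using x(2) kerN_0 proportional_mult unfolding g_def by auto
    qed
    have 2: "kerN c y \<noteq> (\<lambda>_. 0) \<and> kerN c y \<in> ?C \<and> proportional y (kerM c (kerN c y))"
      if y: "y \<in> cspace 4" "y \<noteq> (\<lambda>_. 0)" "h y \<noteq> 0" for y
    proof -
      obtain k where "k \<noteq> 0" "kerM c (kerN c y) = (\<lambda>i. k * y i)"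
        using kerM_kerN[OF y(1,2)] y(3) unfolding h_def by blast
      then show ?thesis
        using y(3) kerM_0 kerN_C proportional_mult unfolding h_def by auto
    qed
    have "\<not> vanishes_on ?C g" "\<not> vanishes_on (cspace 4) h"
      using x0_C g_x0 h_y1 kerM_cspace unfolding vanishes_on_def y1_def by blast+
    then show ?thesis
      unfolding birational_to_Pn_def
      by (intro exI[of _ 3] exI[of _ "\<lambda>j x. kerM c x j"] exI[of _ 4] exI[of _ "\<lambda>i y. kerN c y i"]
          exI[of _ 12] exI[of _ g] exI[of _ h])
        (simp add: pM pN g h kerM_homog kerN_homog 1 2)
  qed
  moreover have "proj_irreducible 5 ?C"
    unfolding proj_irreducible_def
  proof (intro conjI ballI impI)
    show "\<exists>x\<in>?C. x \<noteq> (\<lambda>_. 0)"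
      using x0_C x0_nz by blast
  next
    have fib: "fibre_b t x0 = 0" "fibre_c t x0 = 0" "fibre_point x0 0 = x0"
      using x0 by (auto simp: fibre_b_def fibre_c_def fibre_point_def cspace_def fun_eq_iff)
    \<comment> \<open>The image of \<open>kerN c\<close> contains the open set
      \<open>g \<noteq> 0\<close> of the quartic, which is dense.\<close>
    have dense: "vanishes_on ?C f" if f: "f \<in> polyfun 6" and f0: "\<forall>y\<in>cspace 4. f (kerN c y) = 0" for f
      unfolding vanishes_on_def
    proof
      fix x assume "x \<in> ?C"
      show "f x = 0"
      proof (rule quartic_cone_dense[OF t f _ _ fib(1,2) _ \<open>x \<in> ?C\<close>])
        show "g \<in> polyfun 6" "g (fibre_point x0 0) \<noteq> 0"
          using g g_x0 fib(3) by (auto simp: homog_def)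
      next
        fix x assume "x \<in> ?C" "g x \<noteq> 0"
        then obtain k where k: "k \<noteq> 0" "kerN c (kerM c x) = (\<lambda>i. k * x i)"
          using kerN_kerM unfolding g_def by blast
        \<comment> \<open>As \<open>kerN\<close> has degree 4, a fourth root of \<open>1 / k\<close>
          rescales the preimage to hit \<open>x\<close> itself.\<close>
        define s where "s = csqrt (csqrt (1 / k))"
        have "s ^ 4 = (s ^ 2) ^ 2"
          by (simp flip: power_mult)
        then have "s ^ 4 = 1 / k"
          by (simp add: s_def)
        then have "kerN c (\<lambda>i. s * kerM c x i) = x"
          using k by (simp add: kerN_scale fun_eq_iff)
        moreover have "(\<lambda>i. s * kerM c x i) \<in> cspace 4"
          using kerM_cspace[of x] by (simp add: cspace_def)
        ultimately show "f x = 0"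
          using f0 by metis
      qed
    qed
    fix f1 f2 assume f: "f1 \<in> polyfun (Suc 5)" "f2 \<in> polyfun (Suc 5)"
      and v: "vanishes_on ?C (\<lambda>x. f1 x * f2 x)"
    have "(\<lambda>y. f' (kerN c y)) \<in> polyfun 4" if "f' \<in> polyfun 6" for f'
      using kerN_homog by (intro polyfun_compose[OF that]) (simp add: homog_def)
    then have "(\<forall>y\<in>cspace 4. f1 (kerN c y) = 0) \<or> (\<forall>y\<in>cspace 4. f2 (kerN c y) = 0)"
      using f v kerN_C by (intro polyfun_mult_eq_0) (auto simp: vanishes_on_def)
    then show "vanishes_on ?C f1 \<or> vanishes_on ?C f2"
      using dense f by auto
  qed
  ultimately show ?thesis
    unfolding rational_proj_variety_def using proj_alg_set_quartic_cone by blast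
qed

section \<open>Two determinantal representations\<close>

text \<open>Three anticommuting matrices with square \<open>-1\<close>, which exist over \<open>\<rat>(w)\<close>.\<close>

definition quat_unit :: "complex \<Rightarrow> nat \<Rightarrow> nat \<Rightarrow> nat \<Rightarrow> complex" where
  "quat_unit w k i j = ([[[0, -1], [1, 0]], [[w, w^2], [w^2, - w]], [[- (w^2), w], [w, w^2]]] ! k ! i ! j)"

text \<open>\<open>l div 2\<close> is the pair containing coordinate \<open>l\<close>, so these are
  the scalar blocks \<open>u\<close> for \<open>e = 1\<close> and \<open>v\<close> for
  \<open>e = 2\<close>.\<close>

definition tensor_diag :: "complex \<Rightarrow> nat \<Rightarrow> nat \<Rightarrow> nat \<Rightarrow> nat \<Rightarrow> complex" where
  "tensor_diag w e i j l = (if i = j then w ^ (e * (l div 2)) else 0)"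

text \<open>The sign turns pair sums into differences, which yields the block
  \<open>X_e\<close>.\<close>

definition tensor_quat :: "complex \<Rightarrow> nat \<Rightarrow> nat \<Rightarrow> nat \<Rightarrow> nat \<Rightarrow> complex" where
  "tensor_quat w e i j l = (-1) ^ l * w ^ (e * (l div 2)) * quat_unit w (l div 2) i j"

definition tensor_1_6 :: "complex \<Rightarrow> nat \<Rightarrow> nat \<Rightarrow> nat \<Rightarrow> complex" where
  "tensor_1_6 w i j l =
    (if i < 2 then
       if j < 2 then tensor_diag w 1 i j l
       else tensor_diag w 1 i (j - 2) l + tensor_quat w 1 i (j - 2) l
     else
       if j < 2 then tensor_diag w 2 (i - 2) j l + tensor_quat w 2 (i - 2) j l
       else 2/3 * tensor_diag w 2 (i - 2) (j - 2) l)"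

definition tensor_7_10 :: "complex \<Rightarrow> complex \<Rightarrow> nat \<Rightarrow> nat \<Rightarrow> nat \<Rightarrow> complex" where
  "tensor_7_10 w r i j l =
    (if i < 2 then
       if j < 2 then tensor_quat w 0 i j l
       else tensor_diag w 1 i (j - 2) l - r * tensor_quat w 1 i (j - 2) l
     else
       if j < 2 then tensor_diag w 2 (i - 2) j l + r * tensor_quat w 2 (i - 2) j l
       else 2/3 * tensor_quat w 0 (i - 2) (j - 2) l)"

lemmas tensor_defs = tensor_1_6_def tensor_7_10_def tensor_diag_def tensor_quat_def quat_unit_def

section \<open>Determinants of the two representations\<close>

text \<open>For 2 x 2 blocks \<open>P\<close>, \<open>Q\<close>, \<open>R\<close>, \<open>S\<close>
  this is \<open>det P * det S + det Q * det R - tr (adj P * Q * adj S * R)\<close>.\<close>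

lemma det4_blocks:
  fixes A :: "nat \<Rightarrow> nat \<Rightarrow> 'a::comm_ring_1"
  defines "p00 \<equiv> A 0 0" and "p01 \<equiv> A 0 1" and "p10 \<equiv> A 1 0" and "p11 \<equiv> A 1 1"
    and "q00 \<equiv> A 0 2" and "q01 \<equiv> A 0 3" and "q10 \<equiv> A 1 2" and "q11 \<equiv> A 1 3"
    and "r00 \<equiv> A 2 0" and "r01 \<equiv> A 2 1" and "r10 \<equiv> A 3 0" and "r11 \<equiv> A 3 1"
    and "s00 \<equiv> A 2 2" and "s01 \<equiv> A 2 3" and "s10 \<equiv> A 3 2" and "s11 \<equiv> A 3 3"
  shows "det4 A 0 1 2 3 =
      (p00 * p11 - p01 * p10) * (s00 * s11 - s01 * s10) + (q00 * q11 - q01 * q10) * (r00 * r11 - r01 * r10)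
    - ((p11 * q00 - p01 * q10) * (s11 * r00 - s01 * r10) + (p11 * q01 - p01 * q11) * (s00 * r10 - s10 * r00)
     + (p00 * q10 - p10 * q00) * (s11 * r01 - s01 * r11) + (p00 * q11 - p10 * q01) * (s00 * r11 - s10 * r01))"
  unfolding assms by (simp add: det4_def det3_def algebra_simps)

text \<open>Rewrite rules to the basis \<open>1\<close>, \<open>w\<close>; the nested form matches
  right-associated products.\<close>

lemma omega_reduce:
  fixes w :: complex
  assumes "w * w = - 1 - w"
  shows "w * (w * z) = - z - w * z" "w ^ 2 = - 1 - w" "w ^ 3 = 1" "w ^ 4 = w"
proof -
  show *: "w * (w * z) = - z - w * z" for z
    unfolding mult.assoc[symmetric] assms by (simp add: algebra_simps)
  show "w ^ 2 = - 1 - w" "w ^ 3 = 1" "w ^ 4 = w"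
    by (simp_all add: power2_eq_square power3_eq_cube power4_eq_xxxx assms * algebra_simps)
qed

text \<open>On the hyperplane the third pair sum is \<open>- (s + p)\<close>. The formulas for
  \<open>u^2\<close> and \<open>v^2\<close> are conjugate under exchanging \<open>w\<close> and
  \<open>w^2\<close>.\<close>

lemma omega_products:
  fixes u v :: complex
  assumes w: "w * w = - 1 - w"
    and "u = s + w * p - w^2 * (s + p)" "v = s + w^2 * p - w * (s + p)"
  shows "u * v = 3 * (s^2 + s * p + p^2)" "u^2 = 3 * ((1 + w) * s^2 + 2 * w * s * p - p^2)"
   "v^2 = - 3 * (w * s^2 + 2 * (1 + w) * s * p + p^2)"
  by (simp_all add: assms power2_eq_square omega_reduce(1)[OF w] algebra_simps)

lemma quartic_coords:
  fixes x :: "nat \<Rightarrow> complex"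
  assumes "(\<Sum>i<6. x i) = 0"
  shows "x 0 = ((x 0 + x 1) + (x 0 - x 1)) / 2" "x 1 = ((x 0 + x 1) - (x 0 - x 1)) / 2"
    "x 2 = ((x 2 + x 3) + (x 2 - x 3)) / 2" "x 3 = ((x 2 + x 3) - (x 2 - x 3)) / 2"
    "x 4 = ((x 4 - x 5) - (x 0 + x 1) - (x 2 + x 3)) / 2" "x 5 = - ((x 4 - x 5) + (x 0 + x 1) + (x 2 + x 3)) / 2"
proof -
  have "x 5 = - (x 0 + x 1 + x 2 + x 3 + x 4)"
    using assms by (simp add: sum_less_6 add_eq_0_iff add.commute)
  then show "x 0 = ((x 0 + x 1) + (x 0 - x 1)) / 2" "x 1 = ((x 0 + x 1) - (x 0 - x 1)) / 2"
    "x 2 = ((x 2 + x 3) + (x 2 - x 3)) / 2" "x 3 = ((x 2 + x 3) - (x 2 - x 3)) / 2"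
    "x 4 = ((x 4 - x 5) - (x 0 + x 1) - (x 2 + x 3)) / 2" "x 5 = - ((x 4 - x 5) + (x 0 + x 1) + (x 2 + x 3)) / 2"
    by simp_all
qed

text \<open>The factor 12 can be read off where all differences vanish: the determinant is
  \<open>(u v)^2 / 9 = (s^2 + s p + p^2)^2\<close>, the quartic \<open>1/4 - 1/6\<close> times
  this.\<close>

lemma det_tensor_1_6:
  fixes x :: "nat \<Rightarrow> complex"
  assumes w: "w * w = - 1 - w" and x: "(\<Sum>i<6. x i) = 0"
  shows "det4 (matM (tensor_1_6 w) x) 0 1 2 3 = 12 * ((\<Sum>i<6. x i ^ 4) - 1/6 * (\<Sum>i<6. x i ^ 2) ^ 2)"
proof -
  note red = omega_reduce[OF w]
  define s p a b d where "s = x 0 + x 1" and "p = x 2 + x 3"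
    and "a = x 0 - x 1" and "b = x 2 - x 3" and "d = x 4 - x 5"
  define u v where "u = s + w * p - w^2 * (s + p)" and "v = s + w^2 * p - w * (s + p)"
  have xs: "x 0 = (s + a) / 2" "x 1 = (s - a) / 2" "x 2 = (p + b) / 2" "x 3 = (p - b) / 2"
    "x 4 = (d - s - p) / 2" "x 5 = - (d + s + p) / 2"
    using quartic_coords[OF x] unfolding s_def p_def a_def b_def d_def by blast+
  let ?M = "matM (tensor_1_6 w) x"
  define q00 q01 q10 q11 where "q00 = u + w^2 * b - w * d" and "q01 = - a + b + d"
    and "q10 = a + b + d" and "q11 = u - w^2 * b + w * d"
  define r00 r01 r10 r11 where "r00 = v + b - d" and "r01 = - a + w * b + w^2 * d"
    and "r10 = a + w * b + w^2 * d" and "r11 = v - b + d"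
  define z where "z = 2/3 * v"
  note block_defs = q00_def q01_def q10_def q11_def r00_def r01_def r10_def r11_def z_def
  have entries: "?M 0 0 = u" "?M 0 1 = 0" "?M 0 2 = q00" "?M 0 3 = q01"
    "?M 1 0 = 0" "?M 1 1 = u" "?M 1 2 = q10" "?M 1 3 = q11"
    "?M 2 0 = r00" "?M 2 1 = r01" "?M 2 2 = z" "?M 2 3 = 0"
    "?M 3 0 = r10" "?M 3 1 = r11" "?M 3 2 = 0" "?M 3 3 = z"
    unfolding matM_def sum_less_6 xs u_def v_def block_defs
    by (simp_all add: tensor_defs red w field_simps)
  \<comment> \<open>Quaternion norms of \<open>u + X_1\<close> and \<open>v + X_2\<close>, and the
    trace of their product.\<close>
  have Q: "q00 * q11 - q01 * q10 = u^2 + (a^2 + w^2 * b^2 + w * d^2)"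
    and R: "r00 * r11 - r01 * r10 = v^2 + (a^2 + w * b^2 + w^2 * d^2)"
    and T: "q00 * r00 + q01 * r10 + q10 * r01 + q11 * r11 = 2 * (u * v) - 2 * (a^2 + b^2 + d^2)"
    unfolding block_defs by (simp_all add: power2_eq_square w red(1) algebra_simps)
  have "det4 ?M 0 1 2 3 = (u * z)^2 + (q00 * q11 - q01 * q10) * (r00 * r11 - r01 * r10)
      - u * z * (q00 * r00 + q01 * r10 + q10 * r01 + q11 * r11)"
    unfolding det4_blocks entries by (simp add: power2_eq_square algebra_simps)
  also have "\<dots> = 4/9 * (u * v)^2 + (u^2 + (a^2 + w^2 * b^2 + w * d^2)) * (v^2 + (a^2 + w * b^2 + w^2 * d^2))
      - 2/3 * (u * v) * (2 * (u * v) - 2 * (a^2 + b^2 + d^2))"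
    unfolding Q R T z_def by (simp add: power2_eq_square mult_ac)
  also have "\<dots> = (s^2 + s * p + p^2 - (a^2 + b^2 + d^2))^2 + 9 * (s^2 * a^2 + p^2 * b^2 + (s + p)^2 * d^2)
      - 3 * (a^2 * b^2 + a^2 * d^2 + b^2 * d^2)"
    unfolding omega_products[OF w u_def v_def] by (simp add: power2_eq_square w red(1) algebra_simps)
  also have "\<dots> = 12 * ((\<Sum>i<6. x i ^ 4) - 1/6 * (\<Sum>i<6. x i ^ 2) ^ 2)"
    unfolding sum_less_6 xs by (simp add: power2_eq_square power4_eq_xxxx field_simps)
  finally show ?thesis .
qed

text \<open>Where all differences vanish, the determinant is
  \<open>(u v)^2 = 9 (s^2 + s p + p^2)^2\<close> and the quartic is
  \<open>(1/4 - 7/10) (s^2 + s p + p^2)^2\<close>; hence the factor \<open>- 20\<close>.\<close>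

lemma det_tensor_7_10:
  fixes x :: "nat \<Rightarrow> complex"
  assumes w: "w * w = - 1 - w" and r: "r * r = - 5/3" and x: "(\<Sum>i<6. x i) = 0"
  shows "det4 (matM (tensor_7_10 w r) x) 0 1 2 3 = - 20 * ((\<Sum>i<6. x i ^ 4) - 7/10 * (\<Sum>i<6. x i ^ 2) ^ 2)"
proof -
  note red = omega_reduce[OF w]
  have rr: "r * (r * z) = - 5/3 * z" for z
    unfolding mult.assoc[symmetric] r ..
  define s p a b d where "s = x 0 + x 1" and "p = x 2 + x 3"
    and "a = x 0 - x 1" and "b = x 2 - x 3" and "d = x 4 - x 5"
  define u v where "u = s + w * p - w^2 * (s + p)" and "v = s + w^2 * p - w * (s + p)"
  have xs: "x 0 = (s + a) / 2" "x 1 = (s - a) / 2" "x 2 = (p + b) / 2" "x 3 = (p - b) / 2"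
    "x 4 = (d - s - p) / 2" "x 5 = - (d + s + p) / 2"
    using quartic_coords[OF x] unfolding s_def p_def a_def b_def d_def by blast+
  let ?M = "matM (tensor_7_10 w r) x"
  define m00 m01 m10 where "m00 = w * b - w^2 * d" and "m01 = - a + w^2 * b + w * d" and "m10 = a + w^2 * b + w * d"
  define q00 q01 q10 q11 where "q00 = u - r * (w^2 * b - w * d)" and "q01 = - r * (- a + b + d)"
    and "q10 = - r * (a + b + d)" and "q11 = u + r * (w^2 * b - w * d)"
  define r00 r01 r10 r11 where "r00 = v + r * (b - d)" and "r01 = r * (- a + w * b + w^2 * d)"
    and "r10 = r * (a + w * b + w^2 * d)" and "r11 = v - r * (b - d)"
  define c :: complex where "c = 2/3"
  note block_defs = c_def m00_def m01_def m10_def q00_def q01_def q10_def q11_def r00_def r01_def r10_def r11_def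
  have entries: "?M 0 0 = m00" "?M 0 1 = m01" "?M 0 2 = q00" "?M 0 3 = q01"
    "?M 1 0 = m10" "?M 1 1 = - m00" "?M 1 2 = q10" "?M 1 3 = q11"
    "?M 2 0 = r00" "?M 2 1 = r01" "?M 2 2 = c * m00" "?M 2 3 = c * m01"
    "?M 3 0 = r10" "?M 3 1 = r11" "?M 3 2 = c * m10" "?M 3 3 = - c * m00"
    unfolding matM_def sum_less_6 xs u_def v_def block_defs
    by (simp_all add: tensor_defs red w field_simps)
  \<comment> \<open>\<open>X_0\<close> has trace 0, so its adjugate is \<open>- X_0\<close>, and
    \<open>T\<close> computes \<open>tr (X_0 * Q * X_0 * R)\<close> for the blocks
    \<open>Q = u - r X_1\<close> and \<open>R = v + r X_2\<close>.\<close>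
  have P: "m00 * (- m00) - m01 * m10 = a^2 + b^2 + d^2"
    and Q: "q00 * q11 - q01 * q10 = u^2 - 5/3 * (a^2 + w^2 * b^2 + w * d^2)"
    and R: "r00 * r11 - r01 * r10 = v^2 - 5/3 * (a^2 + w * b^2 + w^2 * d^2)"
    and T: "(m00 * q00 + m01 * q10) * (m00 * r00 + m01 * r10) + (m00 * q01 + m01 * q11) * (m10 * r00 - m00 * r10)
      + (m10 * q00 - m00 * q10) * (m00 * r01 + m01 * r11) + (m10 * q01 - m00 * q11) * (m10 * r01 - m00 * r11)
      = - 2 * (u * v) * (a^2 + b^2 + d^2)
        + 5/3 * (4 * (a^2 + w * b^2 + w^2 * d^2) * (a^2 + w^2 * b^2 + w * d^2) - 2 * (a^2 + b^2 + d^2)^2)"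
    unfolding block_defs by (simp_all add: power2_eq_square w red(1) r rr algebra_simps)
  have "det4 ?M 0 1 2 3 = c^2 * (m00 * (- m00) - m01 * m10)^2 + (q00 * q11 - q01 * q10) * (r00 * r11 - r01 * r10)
      - c * ((m00 * q00 + m01 * q10) * (m00 * r00 + m01 * r10) + (m00 * q01 + m01 * q11) * (m10 * r00 - m00 * r10)
        + (m10 * q00 - m00 * q10) * (m00 * r01 + m01 * r11) + (m10 * q01 - m00 * q11) * (m10 * r01 - m00 * r11))"
    unfolding det4_blocks entries by (simp add: power2_eq_square algebra_simps)
  also have "\<dots> = 4/9 * (a^2 + b^2 + d^2)^2
      + (u^2 - 5/3 * (a^2 + w^2 * b^2 + w * d^2)) * (v^2 - 5/3 * (a^2 + w * b^2 + w^2 * d^2))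
      - 2/3 * (- 2 * (u * v) * (a^2 + b^2 + d^2)
        + 5/3 * (4 * (a^2 + w * b^2 + w^2 * d^2) * (a^2 + w^2 * b^2 + w * d^2) - 2 * (a^2 + b^2 + d^2)^2))"
    unfolding P Q R T by (simp add: c_def power2_eq_square)
  also have "\<dots> = 9 * (s^2 + s * p + p^2)^2 - 15 * (s^2 * a^2 + p^2 * b^2 + (s + p)^2 * d^2)
      + (a^4 + b^4 + d^4) + 7 * (a^2 * b^2 + a^2 * d^2 + b^2 * d^2)
      + 14 * (s^2 + s * p + p^2) * (a^2 + b^2 + d^2)"
    unfolding omega_products[OF w u_def v_def]
    by (simp add: power2_eq_square power4_eq_xxxx w red(1) algebra_simps add_divide_distrib diff_divide_distrib)
  also have "\<dots> = - 20 * ((\<Sum>i<6. x i ^ 4) - 7/10 * (\<Sum>i<6. x i ^ 2) ^ 2)"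
    unfolding sum_less_6 xs by (simp add: power2_eq_square power4_eq_xxxx field_simps)
  finally show ?thesis .
qed

text \<open>At this point the fibre polynomial of the quartic is \<open>z^4\<close> for every \<open>t\<close>, so that a
  single value of a polynomial decides whether its norm vanishes there.\<close>

definition base_point :: "complex \<Rightarrow> nat \<Rightarrow> complex" where
  "base_point w = (\<lambda>_. 0)(0 := 1, 2 := w, 3 := w^2)"

text \<open>Power sums of the three cube roots of unity vanish for exponents not divisible by
  3.\<close>

lemma base_point:
  assumes w: "w * w = - 1 - w"
  shows "base_point w \<in> cspace 4" "(\<Sum>i<4. base_point w i) = 0"
    "(\<Sum>i<4. base_point w i ^ 2) = 0" "(\<Sum>i<4. base_point w i ^ 4) = 0"
  by (simp_all add: base_point_def cspace_def sum_less_4 power2_eq_square power4_eq_xxxx w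
      omega_reduce(1)[OF w] algebra_simps)

section \<open>Nondegeneracy at the base point\<close>

lemma rational_quartic_1_6: "rational_proj_variety 5 (quartic_cone (1/6))"
proof -
  define w where "w = Complex (- 1/2) (sqrt 3 / 2)"
  have w: "w * w = - 1 - w"
    by (simp add: w_def complex_eq_iff)
  have w0: "w \<noteq> -1"
    by (simp add: w_def complex_eq_iff)
  note red = omega_reduce[OF w]
  \<comment> \<open>Half the cofactor vector at the base point.\<close>
  define y0 :: "nat \<Rightarrow> complex"
    where "y0 = (\<lambda>_. 0)(0 := 2 + 4 * w, 1 := 2 * w - 2, 2 := - 3 - 3 * w, 3 := - 3 - 3 * w)"
  have x0: "base_point w 0 = 1" "base_point w 1 = 0" "base_point w 2 = w" "base_point w 3 = w^2"
    "base_point w 4 = 0" "base_point w 5 = 0"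
    by (simp_all add: base_point_def)
  have y: "y0 0 = 2 + 4 * w" "y0 1 = 2 * w - 2" "y0 2 = - 3 - 3 * w" "y0 3 = - 3 - 3 * w"
    by (simp_all add: y0_def)
  show ?thesis
  proof (rule rational_determinantal_quartic[OF _ _ det_tensor_1_6[OF w] base_point[OF w]])
    show "y0 \<in> cspace 4"
      by (simp add: cspace_def y0_def)
    show "(\<Sum>j<4. matM (tensor_1_6 w) (base_point w) i j * y0 j) = 0" if "i < 4" for i
      using less_4_cases[OF that]
      by (elim disjE) (simp_all add: sum_less_4 sum_less_6 y matM_def x0 tensor_defs red w algebra_simps del: One_nat_def)
    have "kerM (tensor_1_6 w) (base_point w) 2 = - 6 * (1 + w)"
      by (simp add: kerM_def row0_cofactor_def det3_def sum_less_6 matM_def x0 tensor_defs red w algebra_simps del: One_nat_def)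
    then show "kerM (tensor_1_6 w) (base_point w) 2 \<noteq> 0"
      using w0 by (simp add: add_eq_0_iff)
    have "kerN (tensor_1_6 w) y0 0 = 10368"
      by (simp add: kerN_def max_minor_def det4_def det3_def sum_less_4 matN_def y tensor_defs red w
          algebra_simps add_divide_distrib diff_divide_distrib del: One_nat_def)
    then show "kerN (tensor_1_6 w) y0 0 \<noteq> 0"
      by simp
  qed simp_all
qed

lemma rational_quartic_7_10: "rational_proj_variety 5 (quartic_cone (7/10))"
proof -
  define w where "w = Complex (- 1/2) (sqrt 3 / 2)"
  have w: "w * w = - 1 - w"
    by (simp add: w_def complex_eq_iff)
  have w0: "w \<noteq> -2"
    by (simp add: w_def complex_eq_iff)
  note red = omega_reduce[OF w]
  define q where "q = complex_of_real (sqrt 5)"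
  have qq: "q * q = 5"
    by (simp add: q_def flip: of_real_mult)
  have qqz: "q * (q * z) = 5 * z" for z
    unfolding mult.assoc[symmetric] qq ..
  \<comment> \<open>\<open>(1 + 2 * w)^2 = - 3\<close>, so this is a square root of
    \<open>- 5/3\<close>.\<close>
  define r where "r = (1 + 2 * w) * q / 3"
  have r: "r * r = - 5/3"
    by (simp add: r_def qq qqz w red algebra_simps)
  \<comment> \<open>A kernel vector at the base point, scaled to have second entry 2.\<close>
  define y0 :: "nat \<Rightarrow> complex"
    where "y0 = (\<lambda>_. 0)(0 := 4 + 2 * w + 2 * q * (1 + w), 1 := 2, 2 := - 7 - 2 * w - 3 * q,
      3 := - 3 - 6 * w - q * (1 + 2 * w))"
  have x0: "base_point w 0 = 1" "base_point w 1 = 0" "base_point w 2 = w" "base_point w 3 = w^2"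
    "base_point w 4 = 0" "base_point w 5 = 0"
    by (simp_all add: base_point_def)
  have y: "y0 0 = 4 + 2 * w + 2 * q * (1 + w)" "y0 1 = 2" "y0 2 = - 7 - 2 * w - 3 * q"
    "y0 3 = - 3 - 6 * w - q * (1 + 2 * w)"
    by (simp_all add: y0_def)
  show ?thesis
  proof (rule rational_determinantal_quartic[OF _ _ det_tensor_7_10[OF w r] base_point[OF w]])
    show "y0 \<in> cspace 4"
      by (simp add: cspace_def y0_def)
    show "(\<Sum>j<4. matM (tensor_7_10 w r) (base_point w) i j * y0 j) = 0" if "i < 4" for i
      using less_4_cases[OF that]
      by (elim disjE) (simp_all add: sum_less_4 sum_less_6 y matM_def x0 tensor_defs red w r_def qq qqz field_simps del: One_nat_def)
    have "kerM (tensor_7_10 w r) (base_point w) 3 = - 8/3 * q * (2 + w)"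
      by (simp add: kerM_def row0_cofactor_def det3_def sum_less_6 matM_def x0 tensor_defs red w r_def qq qqz field_simps del: One_nat_def)
    then show "kerM (tensor_7_10 w r) (base_point w) 3 \<noteq> 0"
      using w0 by (simp add: q_def add_eq_0_iff)
    \<comment> \<open>The minor without column 3 is computed in stages, each reduced to the basis
      \<open>1\<close>, \<open>w\<close>, \<open>q\<close>, \<open>q * w\<close>, to keep the
      expansion small.\<close>
    let ?N = "matN (tensor_7_10 w r) y0"
    have entries:
      "?N 0 0 = - 2 + 2 * w - 2 * q + 2 * q * w" "?N 0 1 = - 8 + 2 * w - 8 * q + 2 * q * w" "?N 0 2 = - 6 * w - 4 * q - 2 * q * w" "?N 0 4 = 14 + 22 * w + 2 * q + 10 * q * w"
      "?N 1 0 = 10 + 8 * w + 2 * q + 4 * q * w" "?N 1 1 = - 8 - 16 * w - 4 * q - 8 * q * w" "?N 1 2 = 8 + 4 * w" "?N 1 4 = 2 + 10 * w - 2 * q + 2 * q * w"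
      "?N 2 0 = 12 - 2 * w + 4 * q - 2 * q * w" "?N 2 1 = 8 - 10 * w + 4 * q - 2 * q * w" "?N 2 2 = - 10 * w - 6 * q * w" "?N 2 4 = 8 - 12 * w - 8 * q * w"
      "?N 3 0 = 2 * w + 2 * q * w" "?N 3 1 = 16 - 2 * w + 4 * q - 2 * q * w" "?N 3 2 = - 6 * w - 2 * q * w" "?N 3 4 = 12 + 4 * w + 4 * q"
      by (simp_all add: sum_less_4 matN_def y tensor_defs red w r_def qq qqz field_simps del: One_nat_def)
    have minors: "det3 ?N 1 2 3 1 2 4 = - 6336 - 12672 * w - 2880 * q - 5760 * q * w"
      "det3 ?N 1 2 3 0 2 4 = 4800 + 5568 * w + 2112 * q + 2496 * q * w"
      "det3 ?N 1 2 3 0 1 4 = 6336 + 16704 * w + 2880 * q + 7488 * q * w"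
      "det3 ?N 1 2 3 0 1 2 = 4800 - 768 * w + 2112 * q - 384 * q * w"
      unfolding det3_def entries by (simp_all add: w red(1) qq qqz algebra_simps)
    have "kerN (tensor_7_10 w r) y0 3 = - det4 ?N 0 1 2 4"
      by (simp add: kerN_def max_minor_def)
    also have "\<dots> = - 13824 * (20 + 9 * q)"
      unfolding det4_def entries minors by (simp add: w red(1) qq qqz algebra_simps)
    finally have ker: "kerN (tensor_7_10 w r) y0 3 = - 13824 * (20 + 9 * q)" .
    have "20 + 9 * sqrt 5 > 0"
      by (simp add: add_pos_pos)
    then have "complex_of_real (20 + 9 * sqrt 5) \<noteq> 0"
      unfolding of_real_eq_0_iff by linarith
    then have "20 + 9 * q \<noteq> 0"
      by (simp add: q_def)
    then show "kerN (tensor_7_10 w r) y0 3 \<noteq> 0"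
      unfolding ker by (rule no_zero_divisors[rotated]) simp
  qed simp_all
qed

theorem theorem1p3:
  shows "rational_proj_variety 5 (quartic_cone (1/6)) \<and> rational_proj_variety 5 (quartic_cone (7/10))"
  using rational_quartic_1_6 rational_quartic_7_10 by blast

end
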